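(* Let $W$ be any real-valued random variable with finite variance which is not almost surely constant, and put $\mu := \mathbb{E} W$, $\sigma^2 := \operatorname{Var}(W)$ (so $0<\sigma<\infty$). Then there exists a sequence $X_1, X_2, \ldots$ of triplewise independent random variables, each following the same distribution as $W$, such that the standardized partial sums \[ S_n := \frac{1}{\sigma\sqrt{n}}\Bigl(\sum_{k=1}^n X_k - n\mu\Bigr) \] converge in law, as $n\to\infty$, to a probability distribution which is not normal.
   Context: For an integer $K\ge 2$, an indexed family of random variables $X_i$, $i\in I$, is called $K$-tuplewise independent if $X_{i_1},\ldots,X_{i_K}$ are mutually independent for every choice of $K$ distinct indices $i_1,\ldots,i_K$. Triplewise independent means $3$-tuplewise independent. *)

theory Defs
  imports "HOL-Probability.Probability"
begin

definition is_normal_distribution :: "real measure \<Rightarrow> bool" where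
  "is_normal_distribution L \<longleftrightarrow>
     (\<exists>m s. s > 0 \<and> L = density lborel (normal_density m s))"

definition tuplewise_indep :: "'a measure \<Rightarrow> nat \<Rightarrow> ('i \<Rightarrow> 'a \<Rightarrow> real) \<Rightarrow> bool" where
  "tuplewise_indep N K X \<longleftrightarrow>
     (\<forall>J. finite J \<and> card J = K \<longrightarrow> prob_space.indep_vars N (\<lambda>_. borel) X J)"

end

theory Submission
  imports Defs "HOL-Library.Discrete_Functions" "HOL-Real_Asymp.Real_Asymp"
begin

text \<open>
  Attach independent fair signs to the vertices of a complete bipartite graph and let the sign of an
  edge be the product of the signs of its endpoints. Products of one, two or three distinct edge signs
  have mean zero: a product of three contains an odd number of signs from the left side. Hence any
  three edge signs are independent, while over the \<open>m\<^sup>2\<close> edges of an \<open>m \<times> m\<close> block they add up to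
  the product of two independent simple random walks at time \<open>m\<close>, which after division by \<open>m\<close> tends to
  a product of two independent standard normals.

  For a general margin, split the law of \<open>W\<close> as the average of two laws \<open>Q\<^sub>+\<close>, \<open>Q\<^sub>-\<close> with different
  means (tilt it by a multiple of the indicator of \<open>{W > \<mu>}\<close>) and, given the edge signs, draw
  independent variables from \<open>Q\<^sub>+\<close> or \<open>Q\<^sub>-\<close> according to the sign of the edge. In the normalised sum
  the conditional means contribute a multiple of the product of normals, and the conditional
  fluctuations an independent normal variable. The limit has characteristic function
  \<open>exp (- w t\<^sup>2 / 2) / sqrt (1 + c\<^sup>2 t\<^sup>2)\<close> with \<open>c \<noteq> 0\<close>, so it is not normal.
\<close>

subsection \<open>Signs\<close>

definition bool_sign :: "bool \<Rightarrow> real" where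
  "bool_sign b = (if b then 1 else -1)"

lemma bool_sign_simps [simp]: "bool_sign True = 1" "bool_sign False = -1"
  by (simp_all add: bool_sign_def)

lemma bool_sign_eq: "bool_sign (a = b) = bool_sign a * bool_sign b"
  by (cases a; cases b) simp_all

lemma abs_bool_sign [simp]: "\<bar>bool_sign b\<bar> = 1"
  by (cases b) simp_all

lemma bool_sign_square [simp]: "bool_sign b * bool_sign b = 1"
  by (cases b) simp_all

text \<open>A boolean has only two values, so interpolation in its sign is exact. This turns
  expectations of functions of edge signs into mixed moments of these signs.\<close>

lemma bool_sign_affine: "f b = (f True + f False) / 2 + (f True - f False) / 2 * bool_sign b"
  for f :: "bool \<Rightarrow> real"
  by (cases b) (simp_all add: field_simps)

subsection \<open>An enumeration of the edges of a complete bipartite graph\<close>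

text \<open>The edges are listed so that the first \<open>m\<^sup>2\<close> of them form the block \<open>{..<m} \<times> {..<m}\<close>.\<close>

definition edge :: "nat \<Rightarrow> nat \<times> nat" where
  "edge k = (let m = floor_sqrt k; j = k - m\<^sup>2 in if j \<le> m then (m, j) else (j - m - 1, m))"

text \<open>The indices from \<open>m\<^sup>2\<close> to \<open>(m+1)\<^sup>2 - 1\<close> number the
  hook that enlarges the block of side \<open>m\<close> to side \<open>m+1\<close>: first row
  \<open>m\<close> with columns up to \<open>m\<close>, then column \<open>m\<close> with rows below
  \<open>m\<close>.\<close>

lemma edge_cases:
  obtains m j where "k = m\<^sup>2 + j" "j \<le> m" "edge k = (m, j)"
  | m j where "k = m\<^sup>2 + m + 1 + j" "j < m" "edge k = (j, m)"
proof -
  define m where "m = floor_sqrt k"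
  define j where "j = k - m\<^sup>2"
  have k: "k = m\<^sup>2 + j" by (simp add: j_def m_def)
  have "k < (Suc m)\<^sup>2" unfolding m_def by (rule Suc_floor_sqrt_power2_gt)
  hence j: "j \<le> 2 * m" by (simp add: k power2_eq_square)
  have e: "edge k = (if j \<le> m then (m, j) else (j - m - 1, m))"
    by (simp add: edge_def Let_def m_def j_def)
  show ?thesis
  proof (cases "j \<le> m")
    case True
    then show ?thesis using k e that(1) by auto
  next
    case False
    then show ?thesis using k e j that(2)[of m "j - m - 1"] by auto
  qed
qed

text \<open>The first case has row at least column, the second row below column, so the pair
  determines the case, and then \<open>m\<close> and \<open>j\<close>.\<close>

lemma inj_edge: "inj edge"
proof (rule injI)
  fix k l assume eq: "edge k = edge l"
  show "k = l"
    using eq by (cases k rule: edge_cases; cases l rule: edge_cases) auto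
qed

lemma edge_image_square: "edge ` {..<m\<^sup>2} = {..<m} \<times> {..<m}"
proof (rule card_subset_eq)
  show "edge ` {..<m\<^sup>2} \<subseteq> {..<m} \<times> {..<m}"
  proof (rule image_subsetI)
    fix k assume "k \<in> {..<m\<^sup>2}"
    then have k: "k < m\<^sup>2" by simp
    show "edge k \<in> {..<m} \<times> {..<m}"
    proof (cases k rule: edge_cases)
      case (1 n j)
      have "n\<^sup>2 < m\<^sup>2" using k 1 by simp
      then have "n < m" by (rule power2_less_imp_less) simp
      then show ?thesis using 1 by auto
    next
      case (2 n j)
      have "n\<^sup>2 < m\<^sup>2" using k 2 by simp
      then have "n < m" by (rule power2_less_imp_less) simp
      then show ?thesis using 2 by auto
    qed
  qed
  show "card (edge ` {..<m\<^sup>2}) = card ({..<m} \<times> {..<m})"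
    using inj_edge by (subst card_image) (auto simp: card_cartesian_product power2_eq_square intro: inj_on_subset)
qed simp

subsection \<open>Fair coins\<close>

lemma indep_vars_PiM_components:
  assumes "\<And>i. prob_space (M i)"
  shows "prob_space.indep_vars (PiM UNIV M) M (\<lambda>i \<omega>. \<omega> i) UNIV"
proof -
  interpret prob_space "PiM UNIV M" by (intro prob_space_PiM assms)
  have [simp]: "restrict \<omega> UNIV = \<omega>" for \<omega> :: "'a \<Rightarrow> 'b" by (simp add: fun_eq_iff)
  show ?thesis
    using assms by (subst indep_vars_iff_distr_eq_PiM') (auto simp: distr_PiM_component)
qed

lemma integral_PiM_prod_components:
  fixes f :: "'i \<Rightarrow> 'a \<Rightarrow> 'b :: {real_normed_field, banach, second_countable_topology}"
  assumes M: "\<And>i. prob_space (M i)" and "finite J"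
    and f: "\<And>i. i \<in> J \<Longrightarrow> integrable (M i) (f i)"
  shows "(\<integral>\<omega>. (\<Prod>i\<in>J. f i (\<omega> i)) \<partial>PiM UNIV M) = (\<Prod>i\<in>J. \<integral>x. f i x \<partial>M i)"
proof -
  interpret prob_space "PiM UNIV M" by (intro prob_space_PiM M)
  have *: "distr (PiM UNIV M) (M i) (\<lambda>\<omega>. \<omega> i) = M i" for i
    by (rule distr_PiM_component) (auto simp: M)
  have [measurable]: "f i \<in> borel_measurable (M i)" if "i \<in> J" for i
    using f[OF that] by simp
  have **: "integrable (PiM UNIV M) (\<lambda>\<omega>. f i (\<omega> i))"
    "(\<integral>\<omega>. f i (\<omega> i) \<partial>PiM UNIV M) = (\<integral>x. f i x \<partial>M i)" if "i \<in> J" for i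
    using that f[OF that] integrable_distr_eq[of "\<lambda>\<omega>. \<omega> i" "PiM UNIV M" "M i" "f i"]
      integral_distr[of "\<lambda>\<omega>. \<omega> i" "PiM UNIV M" "M i" "f i"] by (auto simp: *)
  have "indep_vars M (\<lambda>i \<omega>. \<omega> i) J"
    by (rule indep_vars_subset[OF indep_vars_PiM_components[OF M]]) simp
  then have "indep_vars (\<lambda>_. borel) (\<lambda>i \<omega>. f i (\<omega> i)) J"
    by (rule indep_vars_compose2) auto
  then show ?thesis
    using \<open>finite J\<close> by (subst indep_vars_lebesgue_integral) (auto simp: **)
qed

definition coins :: "(nat \<Rightarrow> bool) measure" where
  "coins = PiM UNIV (\<lambda>_. measure_pmf (bernoulli_pmf (1/2)))"

interpretation coins: prob_space coins
  unfolding coins_def by (intro prob_space_PiM) (rule measure_pmf.prob_space_axioms)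

interpretation coins2: pair_prob_space coins coins ..

lemma measurable_coin [measurable]: "(\<lambda>\<omega>. \<omega> i) \<in> coins \<rightarrow>\<^sub>M count_space UNIV"
proof -
  have "(\<lambda>\<omega>. \<omega> i) \<in> coins \<rightarrow>\<^sub>M measure_pmf (bernoulli_pmf (1/2))"
    unfolding coins_def by measurable
  then show ?thesis by (simp cong: measurable_cong_sets)
qed

lemma coins_expectation_prod:
  assumes "finite J"
  shows "coins.expectation (\<lambda>\<omega>. \<Prod>i\<in>J. bool_sign (\<omega> i)) = (if J = {} then 1 else 0)"
proof -
  have "coins.expectation (\<lambda>\<omega>. \<Prod>i\<in>J. bool_sign (\<omega> i))
      = (\<Prod>i\<in>J. \<integral>x. bool_sign x \<partial>measure_pmf (bernoulli_pmf (1/2)))"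
    unfolding coins_def
    by (rule integral_PiM_prod_components)
      (auto simp: assms measure_pmf.prob_space_axioms intro: integrable_measure_pmf_finite)
  also have "\<dots> = (if J = {} then 1 else 0)"
    using assms by (auto simp: card_gt_0_iff)
  finally show ?thesis .
qed

lemma coins_expectation_sign: "coins.expectation (\<lambda>\<omega>. bool_sign (\<omega> i)) = 0"
  using coins_expectation_prod[of "{i}"] by simp

lemma coins_expectation_sign2:
  "coins.expectation (\<lambda>\<omega>. bool_sign (\<omega> i) * bool_sign (\<omega> j)) = (if i = j then 1 else 0)"
  using coins_expectation_prod[of "{i, j}"] by (auto simp: coins.prob_space)

text \<open>Repetitions are allowed: equal signs cancel in pairs, and since three is odd at least
  one sign of mean zero survives.\<close>

lemma coins_expectation_sign3:
  "coins.expectation (\<lambda>\<omega>. bool_sign (\<omega> i) * bool_sign (\<omega> j) * bool_sign (\<omega> k)) = 0"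
proof -
  consider "i = j" | "i = k" | "j = k" | "i \<noteq> j" "i \<noteq> k" "j \<noteq> k" by blast
  then show ?thesis
  proof cases
    case 4
    then show ?thesis using coins_expectation_prod[of "{i, j, k}"] by (simp add: mult.assoc)
  next
    case 2
    then have "(\<lambda>\<omega>. bool_sign (\<omega> i) * bool_sign (\<omega> j) * bool_sign (\<omega> k)) = (\<lambda>\<omega>. bool_sign (\<omega> j))"
      by (auto simp: bool_sign_def)
    then show ?thesis by (simp add: coins_expectation_sign)
  qed (simp_all add: mult.assoc coins_expectation_sign)
qed

text \<open>Fubini separates the left and right coins; the uniform bounds supply
  integrability.\<close>

lemma coins2_expectation_mult:
  fixes f g :: "(nat \<Rightarrow> bool) \<Rightarrow> real"
  assumes [measurable]: "f \<in> borel_measurable coins" "g \<in> borel_measurable coins"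
    and "\<And>x. \<bar>f x\<bar> \<le> 1" "\<And>x. \<bar>g x\<bar> \<le> 1"
  shows "(\<integral>s. f (fst s) * g (snd s) \<partial>(coins \<Otimes>\<^sub>M coins)) = coins.expectation f * coins.expectation g"
proof -
  have "integrable (coins \<Otimes>\<^sub>M coins) (\<lambda>(x, y). f x * g y)"
  proof (rule coins2.integrable_const_bound)
    show "AE x in coins \<Otimes>\<^sub>M coins. norm (case x of (x, y) \<Rightarrow> f x * g y) \<le> 1"
      using mult_mono[OF assms(3) assms(4)] by (intro always_eventually) (auto simp: abs_mult)
  qed simp
  from coins2.integral_fst[OF this] show ?thesis
    by (simp add: case_prod_beta')
qed

section \<open>Edge signs and their mixed moments up to order three\<close>

definition edge_sign :: "nat \<Rightarrow> (nat \<Rightarrow> bool) \<times> (nat \<Rightarrow> bool) \<Rightarrow> bool" where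
  "edge_sign k s \<longleftrightarrow> fst s (fst (edge k)) = snd s (snd (edge k))"

abbreviation edge_coins :: "((nat \<Rightarrow> bool) \<times> (nat \<Rightarrow> bool)) measure" where
  "edge_coins \<equiv> coins \<Otimes>\<^sub>M coins"

lemma measurable_edge_sign [measurable]: "edge_sign k \<in> edge_coins \<rightarrow>\<^sub>M count_space UNIV"
  unfolding edge_sign_def[abs_def] by measurable

lemma measurable_bool_sign [measurable]: "bool_sign \<in> count_space UNIV \<rightarrow>\<^sub>M borel"
  by simp

abbreviation edge_val :: "nat \<Rightarrow> (nat \<Rightarrow> bool) \<times> (nat \<Rightarrow> bool) \<Rightarrow> real" where
  "edge_val k s \<equiv> bool_sign (edge_sign k s)"

text \<open>Equality of booleans is multiplication of signs. Keeping the edge sign boolean lets it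
  also serve as an index selecting one of two laws.\<close>

lemma edge_val_eq: "edge_val k s = bool_sign (fst s (fst (edge k))) * bool_sign (snd s (snd (edge k)))"
  by (simp add: edge_sign_def bool_sign_eq)

lemma expectation_edge_val: "(\<integral>s. edge_val k s \<partial>edge_coins) = 0"
  unfolding edge_val_eq
  by (subst coins2_expectation_mult) (simp_all add: coins_expectation_sign)

text \<open>Distinct edges differ in some endpoint, and on that side the expectation of the two
  vertex signs vanishes.\<close>

lemma expectation_edge_val2:
  "(\<integral>s. edge_val k s * edge_val l s \<partial>edge_coins) = (if k = l then 1 else 0)"
proof -
  have "(\<integral>s. edge_val k s * edge_val l s \<partial>edge_coins) =
    (\<integral>s. (bool_sign (fst s (fst (edge k))) * bool_sign (fst s (fst (edge l))))
        * (bool_sign (snd s (snd (edge k))) * bool_sign (snd s (snd (edge l)))) \<partial>edge_coins)"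
    unfolding edge_val_eq by (simp add: mult_ac)
  also have "\<dots> = (if fst (edge k) = fst (edge l) then 1 else 0)
                * (if snd (edge k) = snd (edge l) then 1 else 0)"
    by (subst coins2_expectation_mult) (simp_all add: coins_expectation_sign2 abs_mult)
  also have "\<dots> = (if k = l then 1 else 0)"
    using injD[OF inj_edge, of k l] prod_eqI[of "edge k" "edge l"] by auto
  finally show ?thesis .
qed

text \<open>One side of the graph already forces zero, by the parity argument of
  \<open>coins_expectation_sign3\<close>. With four edges this fails: around a 4-cycle every vertex
  sign occurs twice and the product is 1.\<close>

lemma expectation_edge_val3:
  "(\<integral>s. edge_val j s * edge_val k s * edge_val l s \<partial>edge_coins) = 0"
proof -
  have "(\<integral>s. edge_val j s * edge_val k s * edge_val l s \<partial>edge_coins) =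
    (\<integral>s. (bool_sign (fst s (fst (edge j))) * bool_sign (fst s (fst (edge k))) * bool_sign (fst s (fst (edge l))))
        * (bool_sign (snd s (snd (edge j))) * bool_sign (snd s (snd (edge k))) * bool_sign (snd s (snd (edge l)))) \<partial>edge_coins)"
    unfolding edge_val_eq by (simp add: mult_ac)
  also have "\<dots> = 0"
    by (subst coins2_expectation_mult) (simp_all add: coins_expectation_sign3 abs_mult)
  finally show ?thesis .
qed

lemma integrable_edge_coins_bounded:
  fixes f :: "_ \<Rightarrow> 'b :: {banach, second_countable_topology}"
  assumes "f \<in> borel_measurable edge_coins" "\<And>s. norm (f s) \<le> B"
  shows "integrable edge_coins f"
  by (rule coins2.integrable_const_bound[where B=B]) (use assms in auto)

text \<open>The edge signs are orthonormal, so the second moment of the sum is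
  \<open>card A\<close>; nonnegativity of the variance of its absolute value gives the bound on the
  first moment.\<close>

lemma expectation_abs_sum_edge_val_le:
  assumes "finite A"
  shows "(\<integral>s. \<bar>\<Sum>k\<in>A. edge_val k s\<bar> \<partial>edge_coins) \<le> sqrt (card A)"
proof -
  let ?T = "\<lambda>s. \<Sum>k\<in>A. edge_val k s"
  have bound: "\<bar>?T s\<bar> \<le> card A" for s
    using sum_abs[of "\<lambda>k. edge_val k s" A] by simp
  have int: "integrable edge_coins (\<lambda>s. \<bar>?T s\<bar>)"
    by (rule integrable_edge_coins_bounded[where B="card A"]) (use bound in auto)
  have int2: "integrable edge_coins (\<lambda>s. edge_val k s * edge_val l s)" for k l
    by (rule integrable_edge_coins_bounded[where B=1]) (auto simp: abs_mult)
  have sq: "(?T s)\<^sup>2 = (\<Sum>k\<in>A. \<Sum>l\<in>A. edge_val k s * edge_val l s)" for s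
    by (simp add: power2_eq_square sum_product)
  have int3: "integrable edge_coins (\<lambda>s. \<bar>?T s\<bar>\<^sup>2)"
    unfolding power2_abs sq using int2 by auto
  have "(\<integral>s. \<bar>?T s\<bar> \<partial>edge_coins)\<^sup>2 \<le> (\<integral>s. \<bar>?T s\<bar>\<^sup>2 \<partial>edge_coins)"
    using coins2.variance_eq[OF int int3] coins2.variance_positive[of "\<lambda>s. \<bar>?T s\<bar>"] by simp
  also have "\<dots> = (\<Sum>k\<in>A. \<Sum>l\<in>A. if k = l then 1 else 0)"
    unfolding power2_abs sq using int2 by (simp add: expectation_edge_val2)
  also have "\<dots> = card A" using assms by simp
  finally show ?thesis by (rule real_le_rsqrt)
qed

subsection \<open>Mixing two laws along the edge signs\<close>

text \<open>
  Both candidates \<open>y (k, True)\<close> and \<open>y (k, False)\<close> are drawn for every edge, so that conditional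
  independence given the signs becomes an instance of Fubini's theorem on a product space.
\<close>

definition edge_mixture :: "(bool \<Rightarrow> real measure) \<Rightarrow> (nat \<Rightarrow> real) measure" where
  "edge_mixture Q = distr (edge_coins \<Otimes>\<^sub>M (\<Pi>\<^sub>M i\<in>UNIV. Q (snd i))) (\<Pi>\<^sub>M k\<in>UNIV. borel)
     (\<lambda>(s, y) k. y (k, edge_sign k s))"

locale real_distribution_pair =
  fixes Q :: "bool \<Rightarrow> real measure"
  assumes real_distribution_Q: "real_distribution (Q b)"
begin

sublocale Q: real_distribution "Q b" for b
  by (rule real_distribution_Q)

lemma prob_space_Q: "prob_space (Q b)"
  by (rule Q.prob_space_axioms)

abbreviation "choices \<equiv> (\<Pi>\<^sub>M i\<in>(UNIV :: (nat \<times> bool) set). Q (snd i))"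

lemma prob_space_choices: "prob_space choices"
  by (intro prob_space_PiM prob_space_Q)

lemma measurable_choice [measurable]: "(\<lambda>y. y i) \<in> choices \<rightarrow>\<^sub>M borel"
proof -
  have "(\<lambda>y. y i) \<in> choices \<rightarrow>\<^sub>M Q (snd i)" by simp
  then show ?thesis by (simp cong: measurable_cong_sets)
qed

text \<open>The coordinate is selected by a random index; writing the selection as a case
  distinction between two fixed coordinates makes measurability visible.\<close>

lemma measurable_chosen:
  "(\<lambda>x. snd x (k, edge_sign k (fst x))) \<in> borel_measurable (edge_coins \<Otimes>\<^sub>M choices)"
proof -
  have "(\<lambda>x. snd x (k, edge_sign k (fst x))) =
    (\<lambda>x. if edge_sign k (fst x) then snd x (k, True) else snd x (k, False))"
    by (auto simp: fun_eq_iff)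
  also have "\<dots> \<in> borel_measurable (edge_coins \<Otimes>\<^sub>M choices)"
    by measurable
  finally show ?thesis .
qed

lemma measurable_choose:
  "(\<lambda>(s, y) k. y (k, edge_sign k s)) \<in> (edge_coins \<Otimes>\<^sub>M choices) \<rightarrow>\<^sub>M (\<Pi>\<^sub>M k\<in>UNIV. borel)"
  unfolding case_prod_beta
  by (rule measurable_PiM_single') (auto intro: measurable_chosen)

lemma prob_space_edge_mixture: "prob_space (edge_mixture Q)"
proof -
  interpret C: prob_space choices by (rule prob_space_choices)
  interpret pair_prob_space edge_coins choices ..
  show ?thesis unfolding edge_mixture_def by (rule prob_space_distr) (rule measurable_choose)
qed

lemma measurable_edge_mixture [measurable]: "(\<lambda>\<omega>. \<omega> k) \<in> borel_measurable (edge_mixture Q)"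
  unfolding edge_mixture_def by simp

text \<open>Conditional independence given the signs: by Fubini \<open>s\<close> may be fixed, and
  then the factors read distinct coordinates of the product measure \<open>choices\<close>.\<close>

lemma integral_edge_mixture_prod:
  fixes f :: "nat \<Rightarrow> real \<Rightarrow> 'b :: {real_normed_field, banach, second_countable_topology}"
  assumes "finite J" and f [measurable]: "\<And>k. f k \<in> borel_measurable borel"
    and bound: "\<And>k x. norm (f k x) \<le> 1"
  shows "(\<integral>\<omega>. (\<Prod>k\<in>J. f k (\<omega> k)) \<partial>edge_mixture Q) =
    (\<integral>s. (\<Prod>k\<in>J. \<integral>x. f k x \<partial>Q (edge_sign k s)) \<partial>edge_coins)"
proof -
  interpret C: prob_space choices by (rule prob_space_choices)
  interpret P: pair_prob_space edge_coins choices ..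
  note [measurable] = measurable_chosen
  have int: "integrable (Q b) (f k)" for b k
    by (rule Q.integrable_const_bound[where B=1]) (auto simp: bound)
  have "integrable (edge_coins \<Otimes>\<^sub>M choices) (\<lambda>x. \<Prod>k\<in>J. f k (snd x (k, edge_sign k (fst x))))"
    by (rule P.integrable_const_bound[where B=1])
      (auto simp: prod_norm[symmetric] bound intro!: prod_le_1)
  then have int': "integrable (edge_coins \<Otimes>\<^sub>M choices) (\<lambda>(s, y). \<Prod>k\<in>J. f k (y (k, edge_sign k s)))"
    by (simp add: case_prod_beta')
  have "(\<integral>\<omega>. (\<Prod>k\<in>J. f k (\<omega> k)) \<partial>edge_mixture Q) =
    (\<integral>(s, y). (\<Prod>k\<in>J. f k (y (k, edge_sign k s))) \<partial>(edge_coins \<Otimes>\<^sub>M choices))"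
    unfolding edge_mixture_def
    by (subst integral_distr[OF measurable_choose]) (auto simp: case_prod_beta')
  also have "\<dots> = (\<integral>s. (\<integral>y. (\<Prod>k\<in>J. f k (y (k, edge_sign k s))) \<partial>choices) \<partial>edge_coins)"
    by (rule P.integral_fst[OF int', symmetric])
  also have "\<dots> = (\<integral>s. (\<Prod>k\<in>J. \<integral>x. f k x \<partial>Q (edge_sign k s)) \<partial>edge_coins)"
  proof (intro Bochner_Integration.integral_cong refl)
    fix s
    \<comment> \<open>The index \<open>k\<close> is kept in the pair, so distinct \<open>k\<close>
      select distinct coordinates whatever the signs are.\<close>
    let ?g = "\<lambda>k. (k, edge_sign k s)"
    have inj: "inj_on ?g J" by (auto simp: inj_on_def)
    have "(\<integral>y. (\<Prod>k\<in>J. f k (y (?g k))) \<partial>choices) = (\<integral>y. (\<Prod>i\<in>?g ` J. f (fst i) (y i)) \<partial>choices)"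
      by (simp add: prod.reindex[OF inj])
    also have "\<dots> = (\<Prod>i\<in>?g ` J. \<integral>x. f (fst i) x \<partial>Q (snd i))"
      by (rule integral_PiM_prod_components) (auto simp: int prob_space_Q assms(1))
    finally show "(\<integral>y. (\<Prod>k\<in>J. f k (y (k, edge_sign k s))) \<partial>choices) =
      (\<Prod>k\<in>J. \<integral>x. f k x \<partial>Q (edge_sign k s))"
      by (simp add: prod.reindex[OF inj])
  qed
  finally show ?thesis .
qed

lemma prob_edge_mixture:
  assumes "finite J" and ne: "J \<noteq> {}" and A: "\<And>k. k \<in> J \<Longrightarrow> A k \<in> sets borel"
  shows "measure (edge_mixture Q) (\<Inter>k\<in>J. (\<lambda>\<omega>. \<omega> k) -` A k \<inter> space (edge_mixture Q)) =
    (\<integral>s. (\<Prod>k\<in>J. measure (Q (edge_sign k s)) (A k)) \<partial>edge_coins)"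
proof -
  interpret N: prob_space "edge_mixture Q" by (rule prob_space_edge_mixture)
  let ?E = "\<Inter>k\<in>J. (\<lambda>\<omega>. \<omega> k) -` A k \<inter> space (edge_mixture Q)"
  \<comment> \<open>\<open>A\<close> is only known to be Borel on \<open>J\<close>, while the
    integral formula wants every factor measurable; the empty set is the default elsewhere.\<close>
  let ?A = "\<lambda>k. if k \<in> J then A k else {}"
  have E: "?E \<in> sets (edge_mixture Q)"
    using assms by (intro sets.finite_INT measurable_sets[OF measurable_edge_mixture]) auto
  have "measure (edge_mixture Q) ?E = (\<integral>\<omega>. indicator ?E \<omega> \<partial>edge_mixture Q)"
    using E by simp
  also have "\<dots> = (\<integral>\<omega>. (\<Prod>k\<in>J. indicator (?A k) (\<omega> k)) \<partial>edge_mixture Q)"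
    using ne assms(1) by (intro Bochner_Integration.integral_cong refl)
      (auto simp: indicator_def)
  also have "\<dots> = (\<integral>s. (\<Prod>k\<in>J. \<integral>x. indicator (?A k) x \<partial>Q (edge_sign k s)) \<partial>edge_coins)"
    using A by (intro integral_edge_mixture_prod assms(1)) (auto simp: indicator_def)
  also have "\<dots> = (\<integral>s. (\<Prod>k\<in>J. measure (Q (edge_sign k s)) (A k)) \<partial>edge_coins)"
    using A by (intro Bochner_Integration.integral_cong prod.cong refl) simp
  finally show ?thesis .
qed

lemma integrable_edge_val [simp]: "integrable edge_coins (edge_val l)"
  by (rule integrable_edge_coins_bounded[where B=1]) auto

lemma prob_edge_mixture_single:
  assumes "A \<in> sets borel"
  shows "measure (edge_mixture Q) ((\<lambda>\<omega>. \<omega> k) -` A \<inter> space (edge_mixture Q)) =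
    (measure (Q True) A + measure (Q False) A) / 2"
proof -
  have "measure (edge_mixture Q) ((\<lambda>\<omega>. \<omega> k) -` A \<inter> space (edge_mixture Q)) =
    (\<integral>s. measure (Q (edge_sign k s)) A \<partial>edge_coins)"
    using prob_edge_mixture[of "{k}" "\<lambda>_. A"] assms by simp
  also have "\<dots> = (\<integral>s. (measure (Q True) A + measure (Q False) A) / 2
      + (measure (Q True) A - measure (Q False) A) / 2 * edge_val k s \<partial>edge_coins)"
    by (intro Bochner_Integration.integral_cong refl bool_sign_affine)
  also have "\<dots> = (measure (Q True) A + measure (Q False) A) / 2"
    by (simp add: expectation_edge_val coins2.prob_space)
  finally show ?thesis .
qed

text \<open>Given the signs, the joint probability is a product of three terms
  \<open>a l + b l * edge_val l s\<close>. In its expansion every mixed moment of one, two or three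
  distinct edge signs vanishes, leaving the product of the \<open>a l\<close>, which are the
  marginal probabilities.\<close>

lemma tuplewise_indep_edge_mixture: "tuplewise_indep (edge_mixture Q) 3 (\<lambda>k \<omega>. \<omega> k)"
  unfolding tuplewise_indep_def
proof safe
  fix J :: "nat set" assume J: "finite J" "card J = 3"
  interpret N: prob_space "edge_mixture Q" by (rule prob_space_edge_mixture)
  obtain i j k where ijk: "J = {i, j, k}" "i \<noteq> j" "i \<noteq> k" "j \<noteq> k"
    using J(2) by (auto simp: card_3_iff)
  have "N.prob (\<Inter>l\<in>J. (\<lambda>\<omega>. \<omega> l) -` A l \<inter> space (edge_mixture Q)) =
      (\<Prod>l\<in>J. N.prob ((\<lambda>\<omega>. \<omega> l) -` A l \<inter> space (edge_mixture Q)))"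
    if A: "A \<in> J \<rightarrow> sets borel" for A
  proof -
    define a where "a l = (measure (Q True) (A l) + measure (Q False) (A l)) / 2" for l
    define b where "b l = (measure (Q True) (A l) - measure (Q False) (A l)) / 2" for l
    have ab: "measure (Q (edge_sign l s)) (A l) = a l + b l * edge_val l s" for l s
      unfolding a_def b_def by (rule bool_sign_affine)
    have [simp]: "integrable edge_coins (\<lambda>s. edge_val l s * edge_val m s)" for l m
      by (rule integrable_edge_coins_bounded[where B=1]) (auto simp: abs_mult)
    have [simp]: "integrable edge_coins (\<lambda>s. edge_val l s * edge_val m s * edge_val n s)" for l m n
      by (rule integrable_edge_coins_bounded[where B=1]) (auto simp: abs_mult)
    have "N.prob (\<Inter>l\<in>J. (\<lambda>\<omega>. \<omega> l) -` A l \<inter> space (edge_mixture Q)) =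
        (\<integral>s. (\<Prod>l\<in>J. a l + b l * edge_val l s) \<partial>edge_coins)"
      using A J by (subst prob_edge_mixture) (auto simp: ab)
    also have "\<dots> = (\<integral>s. a i * a j * a k + a i * a j * b k * edge_val k s
        + a i * a k * b j * edge_val j s + a j * a k * b i * edge_val i s
        + a i * b j * b k * (edge_val j s * edge_val k s)
        + a j * b i * b k * (edge_val i s * edge_val k s)
        + a k * b i * b j * (edge_val i s * edge_val j s)
        + b i * b j * b k * (edge_val i s * edge_val j s * edge_val k s) \<partial>edge_coins)"
      using ijk by (intro Bochner_Integration.integral_cong refl) (simp add: algebra_simps)
    also have "\<dots> = a i * a j * a k"
      using ijk by (simp add: expectation_edge_val expectation_edge_val2 expectation_edge_val3
          coins2.prob_space)
    also have "\<dots> = (\<Prod>l\<in>J. N.prob ((\<lambda>\<omega>. \<omega> l) -` A l \<inter> space (edge_mixture Q)))"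
      using ijk A by (simp add: prob_edge_mixture_single a_def)
    finally show ?thesis .
  qed
  \<comment> \<open>The Borel sets themselves serve as the intersection-stable generator. It
    contains the whole space, so the product formula over all of \<open>J\<close> covers subfamilies
    as well.\<close>
  then show "N.indep_vars (\<lambda>_. borel) (\<lambda>k \<omega>. \<omega> k) J"
    using J by (subst N.indep_vars_finite[where E = "\<lambda>_. sets borel"])
      (auto simp: sets.sigma_sets_eq[of borel, simplified] sets.Int_stable)
qed

end

subsection \<open>Convergence of the sum of the edge signs\<close>

lemma norm_integral_le:
  fixes f :: "'a \<Rightarrow> 'b::{banach, second_countable_topology}"
  assumes "integrable M f" "integrable M g" "\<And>x. norm (f x) \<le> g x"
  shows "norm (\<integral>x. f x \<partial>M) \<le> (\<integral>x. g x \<partial>M)"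
  using assms by (intro order.trans[OF integral_norm_bound] integral_mono) auto

text \<open>Sandwich: \<open>1 - u \<le> exp (- u) \<le> 1 / (1 + u) \<le> 1 - u +
  u\<^sup>2\<close>.\<close>

lemma exp_minus_approx:
  fixes u :: real
  assumes "0 \<le> u"
  shows "\<bar>exp (- u) - (1 - u)\<bar> \<le> u\<^sup>2"
proof -
  have "exp (- u) = 1 / exp u" by (simp add: exp_minus field_simps)
  also have "\<dots> \<le> 1 / (1 + u)"
    using assms exp_ge_add_one_self[of u] by (intro divide_left_mono) auto
  also have "\<dots> \<le> 1 - u + u\<^sup>2"
  proof -
    have "(1 - u + u\<^sup>2) * (1 + u) = 1 + u ^ 3" by (simp add: algebra_simps power2_eq_square power3_eq_cube)
    then show ?thesis using assms by (simp add: divide_le_eq)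
  qed
  finally show ?thesis using exp_ge_add_one_self[of "- u"] by simp
qed

lemma cmod_iexp_diff_le: "cmod (iexp x - iexp y) \<le> \<bar>x - y\<bar>"
proof -
  have "iexp x = iexp y * iexp (x - y)"
    by (simp add: exp_add[symmetric] algebra_simps)
  then have "iexp x - iexp y = iexp y * (iexp (x - y) - 1)"
    by (simp only: right_diff_distrib mult_1_right)
  then have "cmod (iexp x - iexp y) = cmod (iexp (x - y) - 1)"
    by (simp add: norm_mult)
  also have "\<dots> \<le> \<bar>x - y\<bar>" using iexp_approx1[of "x - y" 0] by simp
  finally show ?thesis .
qed

lemma abs_exp_minus_diff_le:
  fixes a b :: real
  assumes "0 \<le> a" "0 \<le> b"
  shows "\<bar>exp (- a) - exp (- b)\<bar> \<le> \<bar>a - b\<bar>"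
proof -
  have *: "exp (- x) - exp (- y) \<le> y - x" if "0 \<le> x" "x \<le> y" for x y :: real
  proof -
    have "exp (- x) - exp (- y) = exp (- x) * (1 - exp (- (y - x)))"
      by (simp add: algebra_simps exp_add[symmetric])
    also have "\<dots> \<le> 1 * (y - x)"
      using that exp_ge_add_one_self[of "x - y"] by (intro mult_mono) (auto simp: algebra_simps)
    finally show ?thesis by simp
  qed
  show ?thesis using *[of a b] *[of b a] assms
    by (cases "a \<le> b") (auto simp: abs_if)
qed

text \<open>Since \<open>n\<close> such factors will be multiplied, the error of one has to be
  \<open>o(1/n)\<close>. The mean \<open>m\<close> may differ from the centring
  \<open>\<mu>\<close>; the difference is kept as a phase.\<close>

lemma (in real_distribution) char_gaussian_approx:
  fixes \<tau> \<mu> m v :: real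
  assumes int2: "integrable M (\<lambda>x. x\<^sup>2)"
    and m: "expectation (\<lambda>x. x) = m" and v: "variance (\<lambda>x. x) = v"
  shows "(\<lambda>n. real n * cmod ((\<integral>x. iexp (\<tau> / sqrt n * (x - \<mu>)) \<partial>M) -
      iexp (\<tau> / sqrt n * (m - \<mu>)) * exp (- ((\<tau> / sqrt n)\<^sup>2 * v / 2)))) \<longlonglongrightarrow> 0"
proof -
  have int1: "integrable M (\<lambda>x. x)"
    by (rule square_integrable_imp_integrable[OF _ int2]) simp
  have intX: "integrable M (\<lambda>x. (x - m)\<^sup>2)"
    using int1 int2 by (simp add: power2_diff)
  have v0: "0 \<le> v" using variance_positive[of "\<lambda>x. x"] by (simp add: v)
  \<comment> \<open>The Taylor remainder as a minimum of a quadratic and a cubic term: the quadratic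
    one is an integrable majorant under a finite second moment, the cubic one makes the integrand
    vanish as \<open>t\<close> tends to 0.\<close>
  define K where "K t = expectation (\<lambda>x. min (6 * (x - m)\<^sup>2) (\<bar>t\<bar> * \<bar>x - m\<bar> ^ 3))" for t
  have approx: "cmod ((\<integral>x. iexp (t * (x - \<mu>)) \<partial>M) - iexp (t * (m - \<mu>)) * exp (- (t\<^sup>2 * v / 2)))
      \<le> t\<^sup>2 / 6 * K t + (t\<^sup>2 * v / 2)\<^sup>2" for t
  proof -
    let ?c = "char (distr M borel (\<lambda>x. x - m)) t"
    have "(\<integral>x. iexp (t * (x - \<mu>)) \<partial>M) = (\<integral>x. iexp (t * (m - \<mu>)) * iexp (t * (x - m)) \<partial>M)"
      by (simp add: exp_add[symmetric] algebra_simps)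
    also have "\<dots> = iexp (t * (m - \<mu>)) * ?c"
      by (simp add: char_def integral_distr)
    finally have "cmod ((\<integral>x. iexp (t * (x - \<mu>)) \<partial>M) - iexp (t * (m - \<mu>)) * exp (- (t\<^sup>2 * v / 2)))
        = cmod (iexp (t * (m - \<mu>)) * (?c - exp (- (t\<^sup>2 * v / 2))))"
      by (simp add: algebra_simps)
    also have "\<dots> = cmod (?c - exp (- (t\<^sup>2 * v / 2)))"
      unfolding norm_mult by simp
    \<comment> \<open>The Taylor polynomial \<open>1 - t\<^sup>2 * v / 2\<close> is the common
      comparison point of both terms.\<close>
    also have "\<dots> \<le> cmod (?c - (1 - t\<^sup>2 * v / 2)) + cmod (complex_of_real (1 - t\<^sup>2 * v / 2 - exp (- (t\<^sup>2 * v / 2))))"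
      by (rule order.trans[OF _ norm_triangle_ineq]) simp
    also have "\<dots> \<le> t\<^sup>2 / 6 * K t + (t\<^sup>2 * v / 2)\<^sup>2"
    proof (rule add_mono)
      show "cmod (?c - (1 - t\<^sup>2 * v / 2)) \<le> t\<^sup>2 / 6 * K t"
        unfolding K_def
      proof (rule char_approx3'[where X = "\<lambda>x. x - m"])
        show mean: "expectation (\<lambda>x. x - m) = 0" using int1 m prob_space by simp
        show "variance (\<lambda>x. x - m) = v" unfolding mean using v by (simp add: m)
        show "integrable M (\<lambda>x. x - m)" using int1 by simp
        show "integrable M (\<lambda>x. (x - m)\<^sup>2)" by (rule intX)
      qed simp_all
      show "cmod (complex_of_real (1 - t\<^sup>2 * v / 2 - exp (- (t\<^sup>2 * v / 2)))) \<le> (t\<^sup>2 * v / 2)\<^sup>2"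
        unfolding norm_of_real using exp_minus_approx[of "t\<^sup>2 * v / 2"] v0 by (simp add: abs_minus_commute)
    qed
    finally show ?thesis .
  qed
  have K0: "(\<lambda>n. K (\<tau> / sqrt (real n))) \<longlonglongrightarrow> 0"
  proof -
    have "(\<lambda>n. min (6 * (x - m)\<^sup>2) (\<bar>\<tau> / sqrt (real n)\<bar> * \<bar>x - m\<bar> ^ 3)) \<longlonglongrightarrow> 0" for x
    proof -
      have "(\<lambda>n. \<bar>\<tau>\<bar> * \<bar>x - m\<bar> ^ 3 * (1 / sqrt (real n))) \<longlonglongrightarrow> 0" by real_asymp
      then have "(\<lambda>n. \<bar>\<tau> / sqrt (real n)\<bar> * \<bar>x - m\<bar> ^ 3) \<longlonglongrightarrow> 0" by simp
      from tendsto_min[OF tendsto_const[of "6 * (x - m)\<^sup>2"] this] show ?thesis by (simp add: min_def split: if_splits)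
    qed
    then have "(\<lambda>n. K (\<tau> / sqrt (real n))) \<longlonglongrightarrow> (LINT x|M. 0)"
      unfolding K_def
      by (intro integral_dominated_convergence[where w = "\<lambda>x. 6 * (x - m)\<^sup>2"]) (use intX in auto)
    then show ?thesis by simp
  qed
  show ?thesis
  proof (rule Lim_null_comparison)
    show "\<forall>\<^sub>F n in sequentially. norm (real n * cmod ((\<integral>x. iexp (\<tau> / sqrt n * (x - \<mu>)) \<partial>M) -
      iexp (\<tau> / sqrt n * (m - \<mu>)) * exp (- ((\<tau> / sqrt n)\<^sup>2 * v / 2)))) \<le>
        \<tau>\<^sup>2 / 6 * K (\<tau> / sqrt n) + (\<tau>\<^sup>2 * v / 2)\<^sup>2 / n"
    proof (rule eventually_sequentiallyI[of 1])
      fix n :: nat assume n: "1 \<le> n"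
      have sq: "(\<tau> / sqrt n)\<^sup>2 = \<tau>\<^sup>2 / n" by (simp add: power_divide)
      have "real n * ((\<tau> / sqrt n)\<^sup>2 / 6 * K (\<tau> / sqrt n) + ((\<tau> / sqrt n)\<^sup>2 * v / 2)\<^sup>2) =
        \<tau>\<^sup>2 / 6 * K (\<tau> / sqrt n) + (\<tau>\<^sup>2 * v / 2)\<^sup>2 / n"
        unfolding sq using n by (simp add: field_simps power2_eq_square)
      with mult_left_mono[OF approx[of "\<tau> / sqrt n"], of "real n"]
      show "norm (real n * cmod ((\<integral>x. iexp (\<tau> / sqrt n * (x - \<mu>)) \<partial>M) -
        iexp (\<tau> / sqrt n * (m - \<mu>)) * exp (- ((\<tau> / sqrt n)\<^sup>2 * v / 2)))) \<le>
        \<tau>\<^sup>2 / 6 * K (\<tau> / sqrt n) + (\<tau>\<^sup>2 * v / 2)\<^sup>2 / n"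
        by simp
    qed
    have "(\<lambda>n. (\<tau>\<^sup>2 * v / 2)\<^sup>2 / real n) \<longlonglongrightarrow> 0" by real_asymp
    from tendsto_add[OF tendsto_mult_right_zero[OF K0, of "\<tau>\<^sup>2 / 6"] this]
    show "(\<lambda>n. \<tau>\<^sup>2 / 6 * K (\<tau> / sqrt n) + (\<tau>\<^sup>2 * v / 2)\<^sup>2 / n) \<longlonglongrightarrow> 0" by simp
  qed
qed

text \<open>
  The integrals are the characteristic functions at \<open>\<theta>\<close> of the product of two independent variables
  with law \<open>\<mu> n\<close>; Skorohod's theorem, applied to both factors, reduces the claim to bounded convergence.
\<close>

lemma weak_conv_imp_integral_char_conv:
  fixes \<mu> :: "nat \<Rightarrow> real measure" and M :: "real measure" and \<theta> :: real
  assumes \<mu>: "\<And>n. real_distribution (\<mu> n)" and M: "real_distribution M" and "weak_conv_m \<mu> M"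
  shows "(\<lambda>n. \<integral>a. char (\<mu> n) (\<theta> * a) \<partial>\<mu> n) \<longlonglongrightarrow> (\<integral>a. char M (\<theta> * a) \<partial>M)"
proof -
  obtain \<Omega> :: "real measure" and Y' Y where \<Omega>: "prob_space \<Omega>"
    and Y' [measurable]: "\<And>n. Y' n \<in> borel_measurable \<Omega>" and dY': "\<And>n. distr \<Omega> borel (Y' n) = \<mu> n"
    and "Y \<in> measurable \<Omega> lborel" and dY: "distr \<Omega> borel Y = M"
    and conv: "\<And>x. x \<in> space \<Omega> \<Longrightarrow> (\<lambda>n. Y' n x) \<longlonglongrightarrow> Y x"
    using Skorohod[OF assms] by blast
  then have [measurable]: "Y \<in> borel_measurable \<Omega>" by simp
  interpret \<Omega>: prob_space \<Omega> by fact
  interpret \<mu>: real_distribution "\<mu> n" for n by (rule \<mu>)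
  interpret M: real_distribution M by (rule M)
  \<comment> \<open>Two independent copies of the Skorohod space carry the factors: \<open>x\<close>
    is fixed here and bounded convergence acts in \<open>y\<close>; afterwards it acts in
    \<open>x\<close>.\<close>
  have c: "(\<lambda>n. char (\<mu> n) (\<theta> * Y' n x)) \<longlonglongrightarrow> char M (\<theta> * Y x)" if x: "x \<in> space \<Omega>" for x
  proof -
    have "(\<lambda>n. \<integral>y. iexp (\<theta> * Y' n x * Y' n y) \<partial>\<Omega>) \<longlonglongrightarrow> (\<integral>y. iexp (\<theta> * Y x * Y y) \<partial>\<Omega>)"
    proof (rule integral_dominated_convergence[where w = "\<lambda>_. 1"])
      show "AE y in \<Omega>. (\<lambda>n. iexp (\<theta> * Y' n x * Y' n y)) \<longlonglongrightarrow> iexp (\<theta> * Y x * Y y)"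
        using conv x by (intro AE_I2) (auto intro!: tendsto_intros)
    qed auto
    then show ?thesis
      by (simp add: char_def dY'[symmetric] dY[symmetric] integral_distr)
  qed
  have "(\<lambda>n. \<integral>x. char (\<mu> n) (\<theta> * Y' n x) \<partial>\<Omega>) \<longlonglongrightarrow> (\<integral>x. char M (\<theta> * Y x) \<partial>\<Omega>)"
  proof (rule integral_dominated_convergence[where w = "\<lambda>_. 1"])
    show "AE x in \<Omega>. (\<lambda>n. char (\<mu> n) (\<theta> * Y' n x)) \<longlonglongrightarrow> char M (\<theta> * Y x)"
      using c by (intro AE_I2) auto
  qed (auto simp: \<mu>.cmod_char_le_1)
  moreover have "(\<integral>a. char (\<mu> n) (\<theta> * a) \<partial>\<mu> n) = (\<integral>x. char (\<mu> n) (\<theta> * Y' n x) \<partial>\<Omega>)" for n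
    using integral_distr[of "Y' n" \<Omega> borel "\<lambda>a. char (\<mu> n) (\<theta> * a)"] by (simp add: dY')
  moreover have "(\<integral>a. char M (\<theta> * a) \<partial>M) = (\<integral>x. char M (\<theta> * Y x) \<partial>\<Omega>)"
    using integral_distr[of Y \<Omega> borel "\<lambda>a. char M (\<theta> * a)"] by (simp add: dY)
  ultimately show ?thesis by simp
qed

text \<open>The weighted density is \<open>r\<close> times the centred normal density of standard
  deviation \<open>r = 1 / sqrt (1 + \<theta>\<^sup>2)\<close>, whose total mass is 1.\<close>

lemma std_normal_expectation_exp_square:
  "(\<integral>a. exp (- ((\<theta> * a)\<^sup>2 / 2)) \<partial>std_normal_distribution) = 1 / sqrt (1 + \<theta>\<^sup>2)"
proof -
  define r where "r = 1 / sqrt (1 + \<theta>\<^sup>2)"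
  have pos: "0 < 1 + \<theta>\<^sup>2" by (simp add: add_pos_nonneg)
  have r: "0 < r" "r\<^sup>2 = 1 / (1 + \<theta>\<^sup>2)" using pos by (simp_all add: r_def power_divide)
  have *: "std_normal_density x * exp (- ((\<theta> * x)\<^sup>2 / 2)) = r * normal_density 0 r x" for x
  proof -
    have "sqrt (2 * pi * r\<^sup>2) = sqrt (2 * pi) * r" using r(1) by (simp add: real_sqrt_mult)
    moreover have "- x\<^sup>2 / (2 * r\<^sup>2) = - x\<^sup>2 / 2 + - ((\<theta> * x)\<^sup>2 / 2)"
      unfolding r(2) using pos by (simp add: field_simps power2_eq_square)
    ultimately show ?thesis
      using r(1) by (simp add: normal_density_def exp_add[symmetric])
  qed
  have "(\<integral>a. exp (- ((\<theta> * a)\<^sup>2 / 2)) \<partial>std_normal_distribution) =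
    (\<integral>x. std_normal_density x * exp (- ((\<theta> * x)\<^sup>2 / 2)) \<partial>lborel)"
    by (subst integral_density) auto
  also have "\<dots> = r" using r(1) by (simp add: * )
  finally show ?thesis by (simp add: r_def)
qed

lemma weak_conv_coins_sum:
  "weak_conv_m (\<lambda>m. distr coins borel (\<lambda>\<omega>. (\<Sum>i<m. bool_sign (\<omega> i)) / sqrt m)) std_normal_distribution"
proof -
  have ind: "coins.indep_vars (\<lambda>_. measure_pmf (bernoulli_pmf (1/2))) (\<lambda>i \<omega>. \<omega> i) UNIV"
    unfolding coins_def by (rule indep_vars_PiM_components) (rule measure_pmf.prob_space_axioms)
  have comp: "distr coins (measure_pmf (bernoulli_pmf (1/2))) (\<lambda>\<omega>. \<omega> i) = measure_pmf (bernoulli_pmf (1/2))" for i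
    unfolding coins_def by (rule distr_PiM_component) (auto simp: measure_pmf.prob_space_axioms)
  have "weak_conv_m (\<lambda>m. distr coins borel (\<lambda>\<omega>. (\<Sum>i<m. bool_sign (\<omega> i)) / sqrt (real m * 1\<^sup>2)))
    std_normal_distribution"
  proof (rule coins.central_limit_theorem_zero_mean
      [where \<mu> = "distr (measure_pmf (bernoulli_pmf (1/2))) borel bool_sign"])
    show "coins.indep_vars (\<lambda>_. borel) (\<lambda>i \<omega>. bool_sign (\<omega> i)) UNIV"
      by (rule coins.indep_vars_compose2[OF ind]) simp
    show "distr coins borel (\<lambda>\<omega>. bool_sign (\<omega> n)) = distr (measure_pmf (bernoulli_pmf (1/2))) borel bool_sign" for n
      using distr_distr[of bool_sign "measure_pmf (bernoulli_pmf (1/2))" borel "\<lambda>\<omega>. \<omega> n" coins]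
      by (simp add: comp comp_def)
  qed (auto simp: coins_expectation_sign power2_eq_square coins.prob_space)
  then show ?thesis by simp
qed

section \<open>Sums of edge signs over square blocks and over initial segments\<close>

lemma sum_edge_val_square:
  "(\<Sum>k<m\<^sup>2. edge_val k s) = (\<Sum>i<m. bool_sign (fst s i)) * (\<Sum>j<m. bool_sign (snd s j))"
proof -
  have "(\<Sum>k<m\<^sup>2. edge_val k s) = (\<Sum>e\<in>edge ` {..<m\<^sup>2}. bool_sign (fst s (fst e)) * bool_sign (snd s (snd e)))"
    using inj_edge by (subst sum.reindex) (auto simp: edge_val_eq intro: inj_on_subset)
  then show ?thesis
    by (simp add: edge_image_square sum_product sum.cartesian_product case_prod_beta)
qed

text \<open>The normalised block sum is \<open>A m (fst s) * A m (snd s)\<close>, a product of two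
  independent copies of one variable converging to a standard normal. In the limit, integrating out
  one factor leaves the Gaussian expectation of
  \<open>exp (- ((\<theta> * a)\<^sup>2 / 2))\<close>.\<close>

lemma edge_val_square_char_conv:
  "(\<lambda>m. \<integral>s. iexp (\<theta> * ((\<Sum>k<m\<^sup>2. edge_val k s) / real m)) \<partial>edge_coins) \<longlonglongrightarrow> 1 / sqrt (1 + \<theta>\<^sup>2)"
proof -
  define A where "A m \<omega> = (\<Sum>i<m. bool_sign (\<omega> i)) / sqrt (real m)" for m and \<omega> :: "nat \<Rightarrow> bool"
  have [measurable]: "A m \<in> borel_measurable coins" for m unfolding A_def by measurable
  define \<mu> where "\<mu> m = distr coins borel (A m)" for m
  have \<mu>: "real_distribution (\<mu> m)" for m unfolding \<mu>_def by simp
  interpret \<mu>: real_distribution "\<mu> m" for m by (rule \<mu>)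
  have "weak_conv_m \<mu> std_normal_distribution"
    using weak_conv_coins_sum unfolding \<mu>_def A_def .
  from weak_conv_imp_integral_char_conv[OF \<mu> real_dist_normal_dist this, of \<theta>]
  have "(\<lambda>m. \<integral>a. char (\<mu> m) (\<theta> * a) \<partial>\<mu> m) \<longlonglongrightarrow> 1 / sqrt (1 + \<theta>\<^sup>2)"
    by (simp add: char_std_normal_distribution std_normal_expectation_exp_square)
  moreover have "(\<integral>s. iexp (\<theta> * ((\<Sum>k<m\<^sup>2. edge_val k s) / real m)) \<partial>edge_coins) =
    (\<integral>a. char (\<mu> m) (\<theta> * a) \<partial>\<mu> m)" for m
  proof -
    have int: "integrable edge_coins (\<lambda>(x, y). iexp (\<theta> * A m x * A m y))"
      by (rule integrable_edge_coins_bounded[where B=1]) (auto simp: case_prod_beta')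
    have "(\<Sum>k<m\<^sup>2. edge_val k s) / real m = A m (fst s) * A m (snd s)" for s
      by (simp add: sum_edge_val_square A_def)
    then have "(\<integral>s. iexp (\<theta> * ((\<Sum>k<m\<^sup>2. edge_val k s) / real m)) \<partial>edge_coins) =
      (\<integral>(x, y). iexp (\<theta> * A m x * A m y) \<partial>edge_coins)"
      by (simp add: case_prod_beta' mult.assoc)
    also have "\<dots> = (\<integral>x. \<integral>y. iexp (\<theta> * A m x * A m y) \<partial>coins \<partial>coins)"
      by (rule coins2.integral_fst[OF int, symmetric])
    also have "\<dots> = (\<integral>x. char (\<mu> m) (\<theta> * A m x) \<partial>coins)"
      by (simp add: char_def \<mu>_def integral_distr)
    also have "\<dots> = (\<integral>a. char (\<mu> m) (\<theta> * a) \<partial>\<mu> m)"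
      using integral_distr[of "A m" coins borel "\<lambda>a. char (\<mu> m) (\<theta> * a)"] by (simp add: \<mu>_def[symmetric])
    finally show ?thesis .
  qed
  ultimately show ?thesis by simp
qed

lemma integrable_abs_sum_edge_val [simp]:
  "integrable edge_coins (\<lambda>s. \<bar>\<Sum>k\<in>A. edge_val k s\<bar>)" "integrable edge_coins (\<lambda>s. \<Sum>k\<in>A. edge_val k s)"
proof -
  have "\<bar>\<Sum>k\<in>A. edge_val k s\<bar> \<le> card A" for s
    using sum_abs[of "\<lambda>k. edge_val k s" A] by simp
  then show "integrable edge_coins (\<lambda>s. \<bar>\<Sum>k\<in>A. edge_val k s\<bar>)"
    "integrable edge_coins (\<lambda>s. \<Sum>k\<in>A. edge_val k s)"
    by (auto intro!: integrable_edge_coins_bounded[where B="card A"])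
qed

text \<open>At most \<open>2 * m + 1\<close> edges remain outside the block, so their sum has first
  absolute moment of order \<open>sqrt m\<close>, small against \<open>sqrt n\<close>. Changing the
  normalisation from \<open>m\<close> to \<open>sqrt n\<close> costs at most
  \<open>1 / sqrt n\<close>.\<close>

lemma edge_val_sum_approx:
  assumes n: "1 \<le> n" and m: "m = floor_sqrt n"
  shows "(\<integral>s. \<bar>(\<Sum>k\<in>{1..n}. edge_val k s) / sqrt n - (\<Sum>k<m\<^sup>2. edge_val k s) / real m\<bar> \<partial>edge_coins)
    \<le> (sqrt (2 * sqrt n + 1) + 2) / sqrt n"
proof -
  have m1: "1 \<le> m" using n by (simp add: m Suc_le_eq)
  have mn: "m\<^sup>2 \<le> n" by (simp add: m)
  have nm: "n < (Suc m)\<^sup>2" unfolding m by (rule Suc_floor_sqrt_power2_gt)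
  have "real (m\<^sup>2) \<le> real n" using mn by (rule of_nat_mono)
  then have m_le: "real m \<le> sqrt n" by (intro real_le_rsqrt) simp
  have "real n < real ((Suc m)\<^sup>2)" using nm by (rule of_nat_less_iff[THEN iffD2])
  then have m_ge: "sqrt n < real m + 1" by (intro real_less_lsqrt) (simp_all add: algebra_simps)
  have pos: "0 < sqrt (real n)" "0 < real m" using n m1 by simp_all
  define T where "T s = (\<Sum>k\<in>{1..n}. edge_val k s)" for s
  define R where "R s = (\<Sum>k<m\<^sup>2. edge_val k s)" for s
  define E where "E s = (\<Sum>k\<in>{m\<^sup>2..n}. edge_val k s)" for s
  have "{..n} = {..<m\<^sup>2} \<union> {m\<^sup>2..n}" using mn by auto
  then have "(\<Sum>k\<le>n. edge_val k s) = R s + E s" for s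
    unfolding R_def E_def by (simp add: sum.union_disjoint ivl_disj_int)
  \<comment> \<open>The partial sums start at index 1 while the edges are numbered from 0, hence the
    correction by edge 0.\<close>
  moreover have "(\<Sum>k\<le>n. edge_val k s) = edge_val 0 s + T s" for s
    unfolding T_def atMost_atLeast0 by (subst sum.atLeast_Suc_atMost) auto
  ultimately have TR: "T s = R s + E s - edge_val 0 s" for s by (metis add_diff_cancel_left')
  have bound: "\<bar>T s / sqrt n - R s / real m\<bar> \<le> (\<bar>E s\<bar> + 1) / sqrt n + \<bar>R s\<bar> * (1 / real m - 1 / sqrt n)" for s
  proof -
    have "T s / sqrt n - R s / real m = (E s - edge_val 0 s) / sqrt n - R s * (1 / real m - 1 / sqrt n)"
      by (simp add: TR field_simps add_divide_distrib diff_divide_distrib)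
    also have "\<bar>\<dots>\<bar> \<le> \<bar>(E s - edge_val 0 s) / sqrt n\<bar> + \<bar>R s * (1 / real m - 1 / sqrt n)\<bar>"
      by (rule abs_triangle_ineq4)
    also have "\<dots> \<le> (\<bar>E s\<bar> + 1) / sqrt n + \<bar>R s\<bar> * (1 / real m - 1 / sqrt n)"
    proof (rule add_mono)
      have "\<bar>E s - edge_val 0 s\<bar> \<le> \<bar>E s\<bar> + 1" using abs_triangle_ineq4[of "E s" "edge_val 0 s"] by simp
      then show "\<bar>(E s - edge_val 0 s) / sqrt n\<bar> \<le> (\<bar>E s\<bar> + 1) / sqrt n"
        using pos by (simp add: divide_right_mono)
      have "0 \<le> 1 / real m - 1 / sqrt n" using m_le pos by (simp add: frac_le)
      then show "\<bar>R s * (1 / real m - 1 / sqrt n)\<bar> \<le> \<bar>R s\<bar> * (1 / real m - 1 / sqrt n)"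
        by (simp add: abs_mult)
    qed
    finally show ?thesis .
  qed
  have intE [simp]: "integrable edge_coins (\<lambda>s. \<bar>E s\<bar>)" and intR [simp]: "integrable edge_coins (\<lambda>s. \<bar>R s\<bar>)"
    and "integrable edge_coins T" "integrable edge_coins R"
    unfolding E_def R_def T_def by simp_all
  then have "(\<integral>s. \<bar>T s / sqrt n - R s / real m\<bar> \<partial>edge_coins) \<le>
     (\<integral>s. (\<bar>E s\<bar> + 1) / sqrt n + \<bar>R s\<bar> * (1 / real m - 1 / sqrt n) \<partial>edge_coins)"
    by (intro integral_mono bound) auto
  also have "\<dots> = ((\<integral>s. \<bar>E s\<bar> \<partial>edge_coins) + 1) / sqrt n + (\<integral>s. \<bar>R s\<bar> \<partial>edge_coins) * (1 / real m - 1 / sqrt n)"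
    by (simp add: coins2.prob_space)
  also have "\<dots> \<le> (sqrt (2 * sqrt n + 1) + 1) / sqrt n + real m * (1 / real m - 1 / sqrt n)"
  proof (intro add_mono divide_right_mono mult_right_mono)
    have "(\<integral>s. \<bar>E s\<bar> \<partial>edge_coins) \<le> sqrt (card {m\<^sup>2..n})"
      unfolding E_def by (rule expectation_abs_sum_edge_val_le) simp
    also have "\<dots> \<le> sqrt (2 * sqrt n + 1)"
    proof (rule real_sqrt_le_mono)
      have "card {m\<^sup>2..n} \<le> 2 * m + 1" using nm by (simp add: power2_eq_square)
      then have "real (card {m\<^sup>2..n}) \<le> real (2 * m + 1)" by (rule of_nat_mono)
      then show "real (card {m\<^sup>2..n}) \<le> 2 * sqrt n + 1" using m_le by simp
    qed
    finally show "(\<integral>s. \<bar>E s\<bar> \<partial>edge_coins) \<le> sqrt (2 * sqrt n + 1)" .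
    have "(\<integral>s. \<bar>R s\<bar> \<partial>edge_coins) \<le> sqrt (card {..<m\<^sup>2})"
      unfolding R_def by (rule expectation_abs_sum_edge_val_le) simp
    then show "(\<integral>s. \<bar>R s\<bar> \<partial>edge_coins) \<le> real m" by simp
    show "0 \<le> 1 / real m - 1 / sqrt n" using m_le pos by (simp add: frac_le)
  qed simp_all
  also have "\<dots> \<le> (sqrt (2 * sqrt n + 1) + 2) / sqrt n"
  proof -
    have "real m * (1 / real m - 1 / sqrt n) = (sqrt n - real m) / sqrt n"
      using pos by (simp add: right_diff_distrib diff_divide_distrib)
    also have "\<dots> \<le> 1 / sqrt n" using pos m_ge by (intro divide_right_mono) auto
    finally show ?thesis by (simp add: add_divide_distrib)
  qed
  finally show ?thesis unfolding T_def R_def .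
qed

lemma filterlim_floor_sqrt: "filterlim floor_sqrt at_top sequentially"
  unfolding filterlim_at_top
proof
  fix z :: nat
  show "\<forall>\<^sub>F n in sequentially. z \<le> floor_sqrt n"
    using eventually_ge_at_top[of "z\<^sup>2"] by eventually_elim (rule le_floor_sqrtI)
qed

text \<open>Characteristic functions are Lipschitz under the first-moment distance, so the block
  limit along \<open>floor_sqrt n\<close> carries over to all \<open>n\<close>, with an error of
  order \<open>n\<close> to the power -1/4.\<close>

lemma edge_val_char_conv:
  "(\<lambda>n. \<integral>s. iexp (\<theta> * ((\<Sum>k\<in>{1..n}. edge_val k s) / sqrt n)) \<partial>edge_coins) \<longlonglongrightarrow> 1 / sqrt (1 + \<theta>\<^sup>2)"
proof (rule Lim_transform)
  show "(\<lambda>n. \<integral>s. iexp (\<theta> * ((\<Sum>k<(floor_sqrt n)\<^sup>2. edge_val k s) / real (floor_sqrt n))) \<partial>edge_coins)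
      \<longlonglongrightarrow> 1 / sqrt (1 + \<theta>\<^sup>2)"
    by (rule filterlim_compose[OF edge_val_square_char_conv filterlim_floor_sqrt])
  let ?T = "\<lambda>n s. (\<Sum>k\<in>{1..n}. edge_val k s) / sqrt (real n)"
  let ?R = "\<lambda>n s. (\<Sum>k<(floor_sqrt n)\<^sup>2. edge_val k s) / real (floor_sqrt n)"
  show "(\<lambda>n. (\<integral>s. iexp (\<theta> * ?T n s) \<partial>edge_coins) - (\<integral>s. iexp (\<theta> * ?R n s) \<partial>edge_coins)) \<longlonglongrightarrow> 0"
  proof (rule Lim_null_comparison)
    show "\<forall>\<^sub>F n in sequentially. norm ((\<integral>s. iexp (\<theta> * ?T n s) \<partial>edge_coins) - (\<integral>s. iexp (\<theta> * ?R n s) \<partial>edge_coins))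
       \<le> \<bar>\<theta>\<bar> * ((sqrt (2 * sqrt n + 1) + 2) / sqrt n)"
    proof (rule eventually_sequentiallyI[of 1])
      fix n :: nat assume n: "1 \<le> n"
      have int: "integrable edge_coins (\<lambda>s. iexp (\<theta> * ?R n s))" "integrable edge_coins (\<lambda>s. iexp (\<theta> * ?T n s))"
        by (rule integrable_edge_coins_bounded[where B=1]; auto)+
      have "norm ((\<integral>s. iexp (\<theta> * ?T n s) \<partial>edge_coins) - (\<integral>s. iexp (\<theta> * ?R n s) \<partial>edge_coins)) =
        norm (\<integral>s. iexp (\<theta> * ?T n s) - iexp (\<theta> * ?R n s) \<partial>edge_coins)"
        using int by (subst Bochner_Integration.integral_diff) auto
      also have "\<dots> \<le> (\<integral>s. \<bar>\<theta>\<bar> * \<bar>?T n s - ?R n s\<bar> \<partial>edge_coins)"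
      proof (rule norm_integral_le)
        show "norm (iexp (\<theta> * ?T n s) - iexp (\<theta> * ?R n s)) \<le> \<bar>\<theta>\<bar> * \<bar>?T n s - ?R n s\<bar>" for s
          using cmod_iexp_diff_le[of "\<theta> * ?T n s" "\<theta> * ?R n s"]
          by (simp add: abs_mult[symmetric] right_diff_distrib)
      qed (use int in auto)
      also have "\<dots> = \<bar>\<theta>\<bar> * (\<integral>s. \<bar>?T n s - ?R n s\<bar> \<partial>edge_coins)" by simp
      also have "\<dots> \<le> \<bar>\<theta>\<bar> * ((sqrt (2 * sqrt n + 1) + 2) / sqrt n)"
        by (intro mult_left_mono edge_val_sum_approx n refl) simp
      finally show "norm ((\<integral>s. iexp (\<theta> * ?T n s) \<partial>edge_coins) - (\<integral>s. iexp (\<theta> * ?R n s) \<partial>edge_coins))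
         \<le> \<bar>\<theta>\<bar> * ((sqrt (2 * sqrt n + 1) + 2) / sqrt n)" .
    qed
    show "(\<lambda>n. \<bar>\<theta>\<bar> * ((sqrt (2 * sqrt (real n) + 1) + 2) / sqrt (real n))) \<longlonglongrightarrow> 0"
      by real_asymp
  qed
qed

subsection \<open>Convergence of characteristic functions\<close>

context real_distribution_pair
begin

lemma char_edge_mixture_sum:
  "char (distr (edge_mixture Q) borel (\<lambda>\<omega>. ((\<Sum>k\<in>{1..n}. \<omega> k) - real n * \<mu>) / (\<sigma> * sqrt n))) t =
    (\<integral>s. (\<Prod>k\<in>{1..n}. \<integral>x. iexp (t / \<sigma> / sqrt n * (x - \<mu>)) \<partial>Q (edge_sign k s)) \<partial>edge_coins)"
proof -
  have "t * (((\<Sum>k\<in>{1..n}. \<omega> k) - real n * \<mu>) / (\<sigma> * sqrt n)) = (\<Sum>k\<in>{1..n}. t / \<sigma> / sqrt n * (\<omega> k - \<mu>))"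
    for \<omega> :: "nat \<Rightarrow> real"
    by (simp only: sum_distrib_left[symmetric] sum_subtractf sum_constant card_atLeastAtMost) simp
  then have *: "iexp (t * (((\<Sum>k\<in>{1..n}. \<omega> k) - real n * \<mu>) / (\<sigma> * sqrt n))) =
    (\<Prod>k\<in>{1..n}. iexp (t / \<sigma> / sqrt n * (\<omega> k - \<mu>)))" for \<omega> :: "nat \<Rightarrow> real"
    by (simp only: of_real_sum sum_distrib_left exp_sum finite_atLeastAtMost)
  have "char (distr (edge_mixture Q) borel (\<lambda>\<omega>. ((\<Sum>k\<in>{1..n}. \<omega> k) - real n * \<mu>) / (\<sigma> * sqrt n))) t =
    (\<integral>\<omega>. iexp (t * (((\<Sum>k\<in>{1..n}. \<omega> k) - real n * \<mu>) / (\<sigma> * sqrt n))) \<partial>edge_mixture Q)"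
    unfolding char_def by (rule integral_distr) auto
  also have "\<dots> = (\<integral>\<omega>. (\<Prod>k\<in>{1..n}. iexp (t / \<sigma> / sqrt n * (\<omega> k - \<mu>))) \<partial>edge_mixture Q)"
    unfolding * ..
  also have "\<dots> = (\<integral>s. (\<Prod>k\<in>{1..n}. \<integral>x. iexp (t / \<sigma> / sqrt n * (x - \<mu>)) \<partial>Q (edge_sign k s)) \<partial>edge_coins)"
    by (rule integral_edge_mixture_prod) auto
  finally show ?thesis .
qed

text \<open>Given the signs, each factor is replaced by its Gaussian approximation \<open>z\<close>.
  The product of these is a phase depending on \<open>T n s / sqrt n\<close> times a Gaussian weight
  of average variance \<open>w + d * T n s / n\<close>. As \<open>T n\<close> is of order
  \<open>sqrt n\<close>, the \<open>d\<close> term disappears and the phase is governed by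
  \<open>edge_val_char_conv\<close>.\<close>

lemma char_edge_mixture_conv:
  fixes c \<mu> w d t \<sigma> :: real
  assumes int2: "\<And>b. integrable (Q b) (\<lambda>x. x\<^sup>2)"
    and mean: "\<And>b. Q.expectation b (\<lambda>x. x) = \<mu> + c * bool_sign b"
    and var: "\<And>b. Q.variance b (\<lambda>x. x) = w + d * bool_sign b"
  shows "(\<lambda>n. char (distr (edge_mixture Q) borel
      (\<lambda>\<omega>. ((\<Sum>k\<in>{1..n}. \<omega> k) - real n * \<mu>) / (\<sigma> * sqrt n))) t)
    \<longlonglongrightarrow> exp (- ((t / \<sigma>)\<^sup>2 * w / 2)) / sqrt (1 + (c * (t / \<sigma>))\<^sup>2)"
proof -
  define \<tau> where "\<tau> = t / \<sigma>"
  define T where "T n s = (\<Sum>k\<in>{1..n}. edge_val k s)" for n s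
  define \<psi> where "\<psi> n b = (\<integral>x. iexp (\<tau> / sqrt (real n) * (x - \<mu>)) \<partial>Q b)" for n b
  define z where "z n b = iexp (\<tau> / sqrt (real n) * (c * bool_sign b)) *
      exp (- ((\<tau> / sqrt (real n))\<^sup>2 * (w + d * bool_sign b) / 2))" for n b
  \<comment> \<open>Adding the errors for both signs bounds that of any factor, so
    \<open>\<rho> n\<close> controls all \<open>n\<close> factors uniformly in
    \<open>s\<close>.\<close>
  define \<rho> where "\<rho> n = real n * cmod (\<psi> n True - z n True) + real n * cmod (\<psi> n False - z n False)" for n
  have v0: "0 \<le> w + d * bool_sign b" for b
    using Q.variance_positive[of b "\<lambda>x. x"] unfolding var .
  have w0: "0 \<le> w" using v0[of True] v0[of False] by simp
  have \<rho>: "\<rho> \<longlonglongrightarrow> 0"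
  proof -
    have "(\<lambda>n. real n * cmod (\<psi> n b - z n b)) \<longlonglongrightarrow> 0" for b
      using Q.char_gaussian_approx[OF int2 mean var, of b \<tau> \<mu>] unfolding \<psi>_def z_def by simp
    from tendsto_add[OF this[of True] this[of False]] show ?thesis unfolding \<rho>_def[abs_def] by simp
  qed
  have \<psi>1: "cmod (\<psi> n b) \<le> 1" for n b
    unfolding \<psi>_def
    by (rule order.trans[OF integral_norm_bound]) (use Q.prob_space[of b] in simp)
  have z1: "cmod (z n b) \<le> 1" for n b
    unfolding z_def norm_mult using v0[of b] by simp
  have meas [measurable]: "(\<lambda>s. \<Prod>k\<in>{1..n}. g (edge_sign k s)) \<in> borel_measurable edge_coins"
    for n and g :: "bool \<Rightarrow> complex"
    by measurable
  have step: "cmod ((\<integral>s. (\<Prod>k\<in>{1..n}. \<psi> n (edge_sign k s)) \<partial>edge_coins) -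
      exp (- (\<tau>\<^sup>2 * w / 2)) * (\<integral>s. iexp (c * \<tau> * (T n s / sqrt n)) \<partial>edge_coins))
    \<le> \<rho> n + \<tau>\<^sup>2 * \<bar>d\<bar> / 2 * (1 / sqrt n)" if n: "1 \<le> n" for n
  proof -
    have prod_z: "(\<Prod>k\<in>{1..n}. z n (edge_sign k s)) =
       iexp (c * \<tau> * (T n s / sqrt n)) * exp (- (\<tau>\<^sup>2 * w / 2 + \<tau>\<^sup>2 * d / (2 * n) * T n s))" for s
    proof -
      have "(\<Prod>k\<in>{1..n}. iexp (\<tau> / sqrt (real n) * (c * edge_val k s))) = iexp (c * \<tau> * (T n s / sqrt n))"
        by (simp add: exp_sum[symmetric] T_def sum_distrib_left sum_divide_distrib mult_ac)
      moreover have "(\<Prod>k\<in>{1..n}. exp (- ((\<tau> / sqrt (real n))\<^sup>2 * (w + d * edge_val k s) / 2))) =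
        exp (\<Sum>k\<in>{1..n}. - ((\<tau> / sqrt (real n))\<^sup>2 * (w + d * edge_val k s) / 2))"
        by (simp add: exp_sum)
      moreover have "(\<Sum>k\<in>{1..n}. - ((\<tau> / sqrt (real n))\<^sup>2 * (w + d * edge_val k s) / 2)) =
          - ((\<tau>\<^sup>2 / n / 2) * (\<Sum>k\<in>{1..n}. w + d * edge_val k s))"
        by (simp add: sum_negf sum_distrib_left power_divide)
      moreover have "(\<Sum>k\<in>{1..n}. w + d * edge_val k s) = n * w + d * T n s"
        by (simp add: sum.distrib T_def sum_distrib_left)
      moreover have "(\<tau>\<^sup>2 / n / 2) * (n * w + d * T n s) = \<tau>\<^sup>2 * w / 2 + \<tau>\<^sup>2 * d / (2 * n) * T n s"
        using n by (simp add: field_simps)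
      ultimately show ?thesis unfolding z_def prod.distrib by (simp only: of_real_prod[symmetric])
    qed
    \<comment> \<open>This exponent is a sum of nonnegative conditional variances up to scaling;
      nonnegativity is what the Lipschitz bound for \<open>exp (- x)\<close> requires.\<close>
    have v0': "0 \<le> \<tau>\<^sup>2 * w / 2 + \<tau>\<^sup>2 * d / (2 * n) * T n s" for s
    proof -
      have "0 \<le> \<tau>\<^sup>2 / (2 * n) * (\<Sum>k\<in>{1..n}. w + d * edge_val k s)"
        by (intro mult_nonneg_nonneg sum_nonneg v0) simp
      also have "(\<Sum>k\<in>{1..n}. w + d * edge_val k s) = n * w + d * T n s"
        by (simp add: sum.distrib T_def sum_distrib_left)
      finally show ?thesis using n by (simp add: field_simps)
    qed
    have [measurable]: "T n \<in> borel_measurable edge_coins" unfolding T_def[abs_def] by measurable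
    have absT: "integrable edge_coins (\<lambda>s. \<bar>T n s\<bar>)" unfolding T_def by simp
    have int\<psi>: "integrable edge_coins (\<lambda>s. \<Prod>k\<in>{1..n}. \<psi> n (edge_sign k s))"
      by (rule integrable_edge_coins_bounded[where B=1]) (auto simp: prod_norm[symmetric] \<psi>1 intro!: prod_le_1)
    have intT: "integrable edge_coins (\<lambda>s. iexp (c * \<tau> * (T n s / sqrt n)))"
      by (rule integrable_edge_coins_bounded[where B=1]) auto
    have "(\<integral>s. (\<Prod>k\<in>{1..n}. \<psi> n (edge_sign k s)) \<partial>edge_coins) -
        exp (- (\<tau>\<^sup>2 * w / 2)) * (\<integral>s. iexp (c * \<tau> * (T n s / sqrt n)) \<partial>edge_coins) =
      (\<integral>s. (\<Prod>k\<in>{1..n}. \<psi> n (edge_sign k s)) -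
        exp (- (\<tau>\<^sup>2 * w / 2)) * iexp (c * \<tau> * (T n s / sqrt n)) \<partial>edge_coins)"
      using int\<psi> intT by simp
    also have "cmod \<dots> \<le> (\<integral>s. \<rho> n + \<tau>\<^sup>2 * \<bar>d\<bar> / (2 * n) * \<bar>T n s\<bar> \<partial>edge_coins)"
    proof (rule norm_integral_le)
      fix s
      let ?z = "\<Prod>k\<in>{1..n}. z n (edge_sign k s)"
      \<comment> \<open>All factors have modulus at most 1, so the difference of the products is at
        most the sum of the differences of the factors.\<close>
      have "cmod ((\<Prod>k\<in>{1..n}. \<psi> n (edge_sign k s)) - ?z) \<le>
          (\<Sum>k\<in>{1..n}. cmod (\<psi> n (edge_sign k s) - z n (edge_sign k s)))"
        by (rule norm_prod_diff) (auto simp: \<psi>1 z1)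
      also have "\<dots> \<le> (\<Sum>k\<in>{1..n}. cmod (\<psi> n True - z n True) + cmod (\<psi> n False - z n False))"
      proof (rule sum_mono)
        fix k
        show "cmod (\<psi> n (edge_sign k s) - z n (edge_sign k s)) \<le>
            cmod (\<psi> n True - z n True) + cmod (\<psi> n False - z n False)"
          by (cases "edge_sign k s") auto
      qed
      also have "\<dots> = \<rho> n" by (simp add: \<rho>_def distrib_left)
      finally have 1: "cmod ((\<Prod>k\<in>{1..n}. \<psi> n (edge_sign k s)) - ?z) \<le> \<rho> n" .
      have "?z - exp (- (\<tau>\<^sup>2 * w / 2)) * iexp (c * \<tau> * (T n s / sqrt n)) =
         iexp (c * \<tau> * (T n s / sqrt n)) * complex_of_real
          (exp (- (\<tau>\<^sup>2 * w / 2 + \<tau>\<^sup>2 * d / (2 * n) * T n s)) - exp (- (\<tau>\<^sup>2 * w / 2)))"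
        unfolding prod_z of_real_diff right_diff_distrib by (simp only: mult.commute)
      then have "cmod (?z - exp (- (\<tau>\<^sup>2 * w / 2)) * iexp (c * \<tau> * (T n s / sqrt n))) =
          \<bar>exp (- (\<tau>\<^sup>2 * w / 2 + \<tau>\<^sup>2 * d / (2 * n) * T n s)) - exp (- (\<tau>\<^sup>2 * w / 2))\<bar>"
        by (simp only: norm_mult norm_exp_i_times norm_of_real mult_1_left)
      also have "\<dots> \<le> \<bar>\<tau>\<^sup>2 * w / 2 + \<tau>\<^sup>2 * d / (2 * n) * T n s - \<tau>\<^sup>2 * w / 2\<bar>"
        using w0 by (intro abs_exp_minus_diff_le v0') simp
      also have "\<dots> = \<tau>\<^sup>2 * \<bar>d\<bar> / (2 * n) * \<bar>T n s\<bar>"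
        by (simp add: abs_mult)
      finally have 2: "cmod (?z - exp (- (\<tau>\<^sup>2 * w / 2)) * iexp (c * \<tau> * (T n s / sqrt n))) \<le>
        \<tau>\<^sup>2 * \<bar>d\<bar> / (2 * n) * \<bar>T n s\<bar>" .
      show "cmod ((\<Prod>k\<in>{1..n}. \<psi> n (edge_sign k s)) - exp (- (\<tau>\<^sup>2 * w / 2)) * iexp (c * \<tau> * (T n s / sqrt n))) \<le>
        \<rho> n + \<tau>\<^sup>2 * \<bar>d\<bar> / (2 * n) * \<bar>T n s\<bar>"
        using norm_diff_triangle_le[OF 1 2] .
    qed (use int\<psi> intT absT in auto)
    also have "\<dots> = \<rho> n + \<tau>\<^sup>2 * \<bar>d\<bar> / (2 * n) * (\<integral>s. \<bar>T n s\<bar> \<partial>edge_coins)"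
      using absT by (simp add: coins2.prob_space)
    also have "\<dots> \<le> \<rho> n + \<tau>\<^sup>2 * \<bar>d\<bar> / (2 * n) * sqrt n"
      using expectation_abs_sum_edge_val_le[of "{1..n}"] unfolding T_def
      by (intro add_left_mono mult_left_mono) auto
    also have "\<tau>\<^sup>2 * \<bar>d\<bar> / (2 * n) * sqrt n = \<tau>\<^sup>2 * \<bar>d\<bar> / 2 * (sqrt n / n)" by simp
    also have "sqrt n / n = 1 / sqrt n" using n by (simp add: real_div_sqrt field_simps)
    finally show ?thesis .
  qed
  have lim: "(\<lambda>n. exp (- (\<tau>\<^sup>2 * w / 2)) * (\<integral>s. iexp (c * \<tau> * (T n s / sqrt n)) \<partial>edge_coins))
      \<longlonglongrightarrow> exp (- (\<tau>\<^sup>2 * w / 2)) * (1 / sqrt (1 + (c * \<tau>)\<^sup>2))"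
    unfolding T_def of_real_mult[of "exp (- (\<tau>\<^sup>2 * w / 2))" "1 / sqrt (1 + (c * \<tau>)\<^sup>2)"]
    by (intro tendsto_mult tendsto_const edge_val_char_conv)
  have "(\<lambda>n. \<integral>s. (\<Prod>k\<in>{1..n}. \<psi> n (edge_sign k s)) \<partial>edge_coins)
      \<longlonglongrightarrow> exp (- (\<tau>\<^sup>2 * w / 2)) * (1 / sqrt (1 + (c * \<tau>)\<^sup>2))"
  proof (rule Lim_transform[OF lim], rule Lim_null_comparison)
    show "\<forall>\<^sub>F n in sequentially. norm ((\<integral>s. (\<Prod>k\<in>{1..n}. \<psi> n (edge_sign k s)) \<partial>edge_coins) -
      exp (- (\<tau>\<^sup>2 * w / 2)) * (\<integral>s. iexp (c * \<tau> * (T n s / sqrt n)) \<partial>edge_coins))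
      \<le> \<rho> n + \<tau>\<^sup>2 * \<bar>d\<bar> / 2 * (1 / sqrt n)"
      using step by (rule eventually_sequentiallyI)
    have "(\<lambda>n. \<tau>\<^sup>2 * \<bar>d\<bar> / 2 * (1 / sqrt (real n))) \<longlonglongrightarrow> 0" by real_asymp
    from tendsto_add[OF \<rho> this]
    show "(\<lambda>n. \<rho> n + \<tau>\<^sup>2 * \<bar>d\<bar> / 2 * (1 / sqrt (real n))) \<longlonglongrightarrow> 0" by simp
  qed
  then show ?thesis unfolding char_edge_mixture_sum \<psi>_def \<tau>_def by simp
qed

end

subsection \<open>The limit distribution\<close>

text \<open>
  Given \<open>a\<close>, the sum of \<open>c\<close> times a product of independent standard normals \<open>a\<close>, \<open>b\<close> and an independent
  centred normal of variance \<open>w\<close> is centred normal of variance \<open>c\<^sup>2 a\<^sup>2 + w\<close>; this form needs only two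
  standard normals.
\<close>

definition normal_mixture :: "real \<Rightarrow> real \<Rightarrow> real measure" where
  "normal_mixture c w = distr (std_normal_distribution \<Otimes>\<^sub>M std_normal_distribution) borel
     (\<lambda>(a, b). sqrt (c\<^sup>2 * a\<^sup>2 + w) * b)"

lemma measurable_normal_mixture:
  "(\<lambda>(a, b). sqrt (c\<^sup>2 * a\<^sup>2 + w) * b) \<in> borel_measurable (std_normal_distribution \<Otimes>\<^sub>M std_normal_distribution)"
  by measurable

lemma real_distribution_normal_mixture: "real_distribution (normal_mixture c w)"
proof -
  interpret N: real_distribution std_normal_distribution by (rule real_dist_normal_dist)
  interpret P: pair_prob_space std_normal_distribution std_normal_distribution ..
  show ?thesis unfolding normal_mixture_def
    by (rule P.real_distribution_distr) (rule measurable_normal_mixture)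
qed

text \<open>Integrating over \<open>b\<close> first gives the standard normal characteristic
  function at \<open>t * sqrt (c\<^sup>2 * a\<^sup>2 + w)\<close>; the integral over
  \<open>a\<close> is then \<open>std_normal_expectation_exp_square\<close> at
  \<open>c * t\<close>.\<close>

lemma char_normal_mixture:
  assumes "0 \<le> w"
  shows "char (normal_mixture c w) t = exp (- (t\<^sup>2 * w / 2)) / sqrt (1 + (c * t)\<^sup>2)"
proof -
  interpret N: real_distribution std_normal_distribution by (rule real_dist_normal_dist)
  interpret P: pair_prob_space std_normal_distribution std_normal_distribution ..
  let ?N = std_normal_distribution
  have int: "integrable (?N \<Otimes>\<^sub>M ?N) (\<lambda>(a, b). iexp (t * sqrt (c\<^sup>2 * a\<^sup>2 + w) * b))"
    by (rule P.integrable_const_bound[where B=1]) (auto simp: case_prod_beta')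
  have "char (normal_mixture c w) t = (\<integral>(a, b). iexp (t * sqrt (c\<^sup>2 * a\<^sup>2 + w) * b) \<partial>(?N \<Otimes>\<^sub>M ?N))"
    unfolding char_def normal_mixture_def
    by (subst integral_distr[OF measurable_normal_mixture]) (auto simp: case_prod_beta' mult.assoc)
  also have "\<dots> = (\<integral>a. \<integral>b. iexp (t * sqrt (c\<^sup>2 * a\<^sup>2 + w) * b) \<partial>?N \<partial>?N)"
    by (rule P.integral_fst[OF int, symmetric])
  also have "\<dots> = (\<integral>a. complex_of_real (exp (- (t * sqrt (c\<^sup>2 * a\<^sup>2 + w))\<^sup>2 / 2)) \<partial>?N)"
    unfolding char_def[symmetric] char_std_normal_distribution ..
  also have "\<dots> = (\<integral>a. complex_of_real (exp (- (t\<^sup>2 * w / 2)) * exp (- ((c * t * a)\<^sup>2 / 2))) \<partial>?N)"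
  proof (intro Bochner_Integration.integral_cong refl arg_cong[where f = complex_of_real])
    fix a
    have "(t * sqrt (c\<^sup>2 * a\<^sup>2 + w))\<^sup>2 = t\<^sup>2 * w + (c * t * a)\<^sup>2"
      using assms by (simp add: power_mult_distrib algebra_simps)
    then show "exp (- (t * sqrt (c\<^sup>2 * a\<^sup>2 + w))\<^sup>2 / 2) = exp (- (t\<^sup>2 * w / 2)) * exp (- ((c * t * a)\<^sup>2 / 2))"
      by (simp add: exp_add[symmetric] add_divide_distrib)
  qed
  also have "\<dots> = complex_of_real (exp (- (t\<^sup>2 * w / 2)) * (\<integral>a. exp (- ((c * t * a)\<^sup>2 / 2)) \<partial>?N))"
    by simp
  finally show ?thesis by (simp only: std_normal_expectation_exp_square) simp
qed

text \<open>The modulus discards the phase produced by the mean, so only variances have to be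
  compared.\<close>

lemma cmod_char_normal_distribution:
  assumes "0 < s"
  shows "cmod (char (density lborel (normal_density m s)) t) = exp (- (t\<^sup>2 * s\<^sup>2 / 2))"
proof -
  interpret N: real_distribution std_normal_distribution by (rule real_dist_normal_dist)
  have "distributed std_normal_distribution lborel (\<lambda>x. x) std_normal_density"
    by (auto simp: distributed_def distr_id2)
  then have "distributed std_normal_distribution lborel (\<lambda>x. m + s * x) (normal_density (m + s * 0) (\<bar>s\<bar> * 1))"
    using assms by (intro N.normal_density_affine) auto
  then have "density lborel (normal_density m s) = distr std_normal_distribution lborel (\<lambda>x. m + s * x)"
    using assms by (simp add: distributed_def)
  also have "\<dots> = distr std_normal_distribution borel (\<lambda>x. m + s * x)"
    by (rule distr_cong) auto
  finally have "char (density lborel (normal_density m s)) t =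
      (\<integral>x. iexp (t * (m + s * x)) \<partial>std_normal_distribution)"
    by (simp add: char_def integral_distr)
  also have "\<dots> = (\<integral>x. iexp (t * m) * iexp ((t * s) * x) \<partial>std_normal_distribution)"
    by (simp add: exp_add[symmetric] algebra_simps)
  also have "\<dots> = iexp (t * m) * char std_normal_distribution (t * s)"
    by (simp add: char_def)
  finally show ?thesis
    by (simp add: norm_mult char_std_normal_distribution power_mult_distrib)
qed

text \<open>Equal characteristic functions would make the logarithm of
  \<open>1 + (c * t)\<^sup>2\<close> a multiple of \<open>t\<^sup>2\<close>.\<close>

lemma normal_mixture_not_normal:
  assumes "c \<noteq> 0" "0 \<le> w"
  shows "\<not> is_normal_distribution (normal_mixture c w)"
proof
  assume "is_normal_distribution (normal_mixture c w)"
  then obtain m s where s: "0 < s" and eq: "normal_mixture c w = density lborel (normal_density m s)"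
    unfolding is_normal_distribution_def by blast
  have key: "ln (1 + (c * t)\<^sup>2) = (s\<^sup>2 - w) * t\<^sup>2" for t
  proof -
    have pos: "0 < 1 + (c * t)\<^sup>2" by (simp add: add_pos_nonneg)
    have "exp (- (t\<^sup>2 * s\<^sup>2 / 2)) = cmod (char (normal_mixture c w) t)"
      unfolding eq using s by (rule cmod_char_normal_distribution[symmetric])
    also have "\<dots> = exp (- (t\<^sup>2 * w / 2)) / sqrt (1 + (c * t)\<^sup>2)"
      unfolding char_normal_mixture[OF assms(2)] using pos by (simp add: norm_divide)
    finally have "ln (exp (- (t\<^sup>2 * s\<^sup>2 / 2))) = ln (exp (- (t\<^sup>2 * w / 2)) / sqrt (1 + (c * t)\<^sup>2))"
      by simp
    also have "\<dots> = - (t\<^sup>2 * w / 2) - ln (1 + (c * t)\<^sup>2) / 2"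
      using pos by (subst ln_div) (auto simp: ln_sqrt)
    finally show ?thesis by (simp add: field_simps)
  qed
  \<comment> \<open>At \<open>1 / c\<close> and \<open>sqrt 3 / c\<close> the argument of the
    logarithm is 2 and 4, which forces \<open>ln 4 = 3 * ln 2\<close> instead of
    \<open>2 * ln 2\<close>.\<close>
  define k where "k = (s\<^sup>2 - w) / c\<^sup>2"
  have "ln 2 = k"
    using key[of "1 / c"] assms(1) by (simp add: k_def power_divide)
  moreover have "ln 4 = 3 * k"
    using key[of "sqrt 3 / c"] assms(1) by (simp add: k_def power_divide)
  moreover have "ln 4 = 2 * ln (2 :: real)"
    using ln_realpow[of 2 2] by simp
  ultimately show False using ln_gt_zero[of "2::real"] by simp
qed

subsection \<open>Splitting a law into two laws with different means\<close>

context real_distribution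
begin

text \<open>A centred indicator: bounded by 1, so \<open>1 + tilt\<close> and
  \<open>1 - tilt\<close> are nonnegative; of mean zero, so both are probability densities; and
  positively correlated with the identity when the law is not constant.\<close>

definition tilt :: "real \<Rightarrow> real" where
  "tilt x = indicator {expectation (\<lambda>x. x)<..} x - prob {expectation (\<lambda>x. x)<..}"

definition tilted :: "bool \<Rightarrow> real measure" where
  "tilted b = density M (\<lambda>x. ennreal (1 + bool_sign b * tilt x))"

lemma measurable_tilt [measurable]: "tilt \<in> borel_measurable borel"
  unfolding tilt_def[abs_def] by measurable

lemma abs_tilt_le: "\<bar>tilt x\<bar> \<le> 1"
proof -
  obtain p where p: "p = prob {expectation (\<lambda>x. x)<..}" "0 \<le> p" "p \<le> 1"
    by simp
  then show ?thesis
    unfolding tilt_def p(1)[symmetric] by (simp add: indicator_def)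
qed

lemma tilted_density_nonneg: "0 \<le> 1 + bool_sign b * tilt x"
  using abs_tilt_le[of x] by (cases b) auto

lemma integrable_tilt_mult:
  assumes "integrable M f"
  shows "integrable M (\<lambda>x. tilt x * f x)"
proof (rule Bochner_Integration.integrable_bound[OF assms])
  show "AE x in M. norm (tilt x * f x) \<le> norm (f x)"
    using abs_tilt_le by (auto simp: abs_mult mult_left_le_one_le)
qed (use assms in auto)

lemma
  assumes f: "integrable M f"
  shows integrable_tilted: "integrable (tilted b) f"
    and integral_tilted: "(\<integral>x. f x \<partial>tilted b) = expectation f + bool_sign b * (\<integral>x. tilt x * f x \<partial>M)"
proof -
  have [measurable]: "f \<in> borel_measurable borel"
    using borel_measurable_integrable[OF f] by simp
  have eq: "(1 + bool_sign b * tilt x) * f x = f x + bool_sign b * (tilt x * f x)" for x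
    by (simp add: algebra_simps)
  show "integrable (tilted b) f"
    unfolding tilted_def using f integrable_tilt_mult[OF f]
    by (subst integrable_real_density) (auto simp: tilted_density_nonneg eq)
  show "(\<integral>x. f x \<partial>tilted b) = expectation f + bool_sign b * (\<integral>x. tilt x * f x \<partial>M)"
    unfolding tilted_def using f integrable_tilt_mult[OF f]
    by (subst integral_real_density) (auto simp: tilted_density_nonneg eq)
qed

lemma integrable_indicator_borel: "A \<in> sets borel \<Longrightarrow> integrable M (indicator A :: real \<Rightarrow> real)"
  by (rule integrable_const_bound[where B=1]) (auto simp: indicator_def)

lemma expectation_tilt: "expectation tilt = 0"
  unfolding tilt_def[abs_def] using prob_space integrable_indicator_borel by simp

lemma real_distribution_tilted: "real_distribution (tilted b)"
proof -
  have sets: "sets (tilted b) = sets borel" by (simp add: tilted_def)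
  have "integrable M tilt"
    using integrable_tilt_mult[of "\<lambda>_. 1"] by simp
  then have int: "integrable M (\<lambda>x. 1 + bool_sign b * tilt x)" by simp
  have "emeasure (tilted b) (space (tilted b)) = (\<integral>\<^sup>+x. ennreal (1 + bool_sign b * tilt x) \<partial>M)"
    unfolding tilted_def by (subst emeasure_density) (auto intro!: nn_integral_cong)
  also have "\<dots> = ennreal (expectation (\<lambda>x. 1 + bool_sign b * tilt x))"
    by (rule nn_integral_eq_integral[OF int]) (simp add: tilted_density_nonneg)
  also have "\<dots> = 1"
    using \<open>integrable M tilt\<close> prob_space by (simp add: expectation_tilt)
  finally have "prob_space (tilted b)" by (rule prob_spaceI)
  then show ?thesis
    using sets by (simp add: real_distribution_def real_distribution_axioms_def)
qed

text \<open>The tilt enters the two laws with opposite signs and cancels.\<close>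

lemma measure_tilted_average:
  assumes "A \<in> sets borel"
  shows "(measure (tilted True) A + measure (tilted False) A) / 2 = prob A"
proof -
  interpret T: real_distribution "tilted b" for b by (rule real_distribution_tilted)
  have int: "integrable M (indicator A :: real \<Rightarrow> real)" by (rule integrable_indicator_borel[OF assms])
  have "measure (tilted b) A = prob A + bool_sign b * (\<integral>x. tilt x * indicator A x \<partial>M)" for b
    using integral_tilted[OF int, of b] assms by simp
  then show ?thesis by simp
qed

text \<open>The covariance equals the expectation of the positive part of \<open>x - \<mu>\<close>.
  If that vanished, the variable would almost surely not exceed its own mean, hence would equal
  it.\<close>

lemma expectation_tilt_pos:
  assumes int: "integrable M (\<lambda>x. x)" and nonconst: "\<not> (\<exists>c. AE x in M. x = c)"
  shows "0 < expectation (\<lambda>x. tilt x * x)"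
proof -
  define \<mu> where "\<mu> = expectation (\<lambda>x. x)"
  let ?g = "\<lambda>x. indicator {\<mu><..} x * (x - \<mu>)"
  have ind: "integrable M (\<lambda>x. indicator {\<mu><..} x * x)"
    using integrable_mult_indicator[OF _ int, of "{\<mu><..}"] by simp
  have ind1: "integrable M (indicator {\<mu><..} :: real \<Rightarrow> real)" by (rule integrable_indicator_borel) simp
  have intg: "integrable M ?g"
    using ind ind1 by (simp add: right_diff_distrib)
  have "expectation (\<lambda>x. tilt x * x) = expectation ?g"
    using ind ind1 int by (simp add: tilt_def \<mu>_def[symmetric] left_diff_distrib right_diff_distrib)
  moreover have "0 \<le> expectation ?g"
    by (rule integral_nonneg_AE) (auto simp: indicator_def)
  moreover have "expectation ?g \<noteq> 0"
  proof
    assume "expectation ?g = 0"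
    then have "AE x in M. ?g x = 0"
      using intg by (subst (asm) integral_nonneg_eq_0_iff_AE) (auto simp: indicator_def)
    then have le: "AE x in M. 0 \<le> \<mu> - x" by eventually_elim (auto simp: indicator_def split: if_splits)
    have "integrable M (\<lambda>x. \<mu> - x)" "expectation (\<lambda>x. \<mu> - x) = 0"
      using int prob_space by (simp_all add: \<mu>_def)
    then have "AE x in M. \<mu> - x = 0"
      using le by (subst (asm) integral_nonneg_eq_0_iff_AE) auto
    then have "AE x in M. x = \<mu>" by eventually_elim simp
    then show False using nonconst by blast
  qed
  ultimately show ?thesis by simp
qed

end

subsection \<open>The counterexample\<close>

theorem theorem1p4:
  fixes M :: "'a measure" and W :: "'a \<Rightarrow> real"
  assumes "prob_space M"
    and "W \<in> borel_measurable M"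
    and "integrable M (\<lambda>x. (W x)\<^sup>2)"
    and "\<not> (\<exists>c. AE x in M. W x = c)"
  shows "\<exists>(N :: (nat \<Rightarrow> real) measure) (X :: nat \<Rightarrow> (nat \<Rightarrow> real) \<Rightarrow> real) L.
           prob_space N
         \<and> (\<forall>k. X k \<in> borel_measurable N)
         \<and> (\<forall>k. distr N borel (X k) = distr M borel W)
         \<and> tuplewise_indep N 3 X
         \<and> real_distribution L
         \<and> weak_conv_m
             (\<lambda>n. distr N borel
                (\<lambda>\<omega>. ((\<Sum>k\<in>{1..n}. X k \<omega>) - real n * prob_space.expectation M W)
                      / (sqrt (prob_space.variance M W) * sqrt (real n))))
             L
         \<and> \<not> is_normal_distribution L"
proof -
  interpret M: prob_space M by fact
  note W [measurable] = assms(2)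
  interpret V: real_distribution "distr M borel W" by simp
  interpret real_distribution_pair V.tilted
    by (rule real_distribution_pair.intro) (rule V.real_distribution_tilted)
  let ?N = "edge_mixture V.tilted"
  interpret N: prob_space ?N by (rule prob_space_edge_mixture)
  have intW: "integrable M W"
    by (rule M.square_integrable_imp_integrable[OF _ assms(3)]) simp
  have int1: "integrable (distr M borel W) (\<lambda>x. x)" and int2: "integrable (distr M borel W) (\<lambda>x. x\<^sup>2)"
    using intW assms(3) by (simp_all add: integrable_distr_eq)
  define \<mu> where "\<mu> = M.expectation W"
  have \<mu>: "V.expectation (\<lambda>x. x) = \<mu>" by (simp add: \<mu>_def integral_distr)
  define \<sigma> where "\<sigma> = sqrt (M.variance W)"
  have "\<sigma> \<noteq> 0"
  proof
    assume "\<sigma> = 0"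
    then have "M.expectation (\<lambda>x. (W x - \<mu>)\<^sup>2) = 0" by (simp add: \<sigma>_def \<mu>_def)
    moreover have "integrable M (\<lambda>x. (W x - \<mu>)\<^sup>2)"
      using intW assms(3) by (simp add: power2_diff)
    ultimately have "AE x in M. (W x - \<mu>)\<^sup>2 = 0"
      by (subst (asm) integral_nonneg_eq_0_iff_AE) auto
    then have "AE x in M. W x = \<mu>" by eventually_elim simp
    then show False using assms(4) by blast
  qed
  \<comment> \<open>Half the difference of the two tilted means; its positivity keeps the product of
    normals in the limit.\<close>
  define c where "c = V.expectation (\<lambda>x. V.tilt x * x)"
  have "0 < c"
    unfolding c_def
  proof (rule V.expectation_tilt_pos[OF int1])
    show "\<not> (\<exists>c. AE x in distr M borel W. x = c)"
      using assms(4) by (simp add: AE_distr_iff)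
  qed
  \<comment> \<open>Half-sum and half-difference of the tilted variances, so that the variance is
    \<open>w + d * bool_sign b\<close>. Only \<open>w\<close> enters the limit.\<close>
  define w where "w = (Q.variance True (\<lambda>x. x) + Q.variance False (\<lambda>x. x)) / 2"
  define d where "d = (Q.variance True (\<lambda>x. x) - Q.variance False (\<lambda>x. x)) / 2"
  have "0 \<le> w" unfolding w_def by (intro divide_nonneg_pos add_nonneg_nonneg Q.variance_positive) simp
  define L where "L = normal_mixture (c / \<sigma>) (w / \<sigma>\<^sup>2)"
  \<comment> \<open>Each coordinate has the average of the two tilted laws, in which the tilts
    cancel.\<close>
  have distr: "distr ?N borel (\<lambda>\<omega>. \<omega> k) = distr M borel W" for k
  proof (rule measure_eqI)
    fix A assume "A \<in> sets (distr ?N borel (\<lambda>\<omega>. \<omega> k))"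
    then have A: "A \<in> sets borel" by simp
    interpret D: prob_space "distr ?N borel (\<lambda>\<omega>. \<omega> k)"
      by (rule N.prob_space_distr) simp
    have "measure (distr ?N borel (\<lambda>\<omega>. \<omega> k)) A = V.prob A"
      using A by (simp add: measure_distr prob_edge_mixture_single V.measure_tilted_average)
    then show "emeasure (distr ?N borel (\<lambda>\<omega>. \<omega> k)) A = emeasure (distr M borel W) A"
      by (simp add: D.emeasure_eq_measure V.emeasure_eq_measure)
  qed simp
  have "weak_conv_m (\<lambda>n. distr ?N borel (\<lambda>\<omega>. ((\<Sum>k\<in>{1..n}. \<omega> k) - real n * \<mu>) / (\<sigma> * sqrt (real n)))) L"
  proof (rule levy_continuity)
    show "real_distribution L" unfolding L_def by (rule real_distribution_normal_mixture)
    fix t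
    have "(\<lambda>n. char (distr ?N borel (\<lambda>\<omega>. ((\<Sum>k\<in>{1..n}. \<omega> k) - real n * \<mu>) / (\<sigma> * sqrt n))) t)
      \<longlonglongrightarrow> exp (- ((t / \<sigma>)\<^sup>2 * w / 2)) / sqrt (1 + (c * (t / \<sigma>))\<^sup>2)"
    proof (rule char_edge_mixture_conv)
      show "integrable (V.tilted b) (\<lambda>x. x\<^sup>2)" for b
        by (rule V.integrable_tilted[OF int2])
      show "Q.expectation b (\<lambda>x. x) = \<mu> + c * bool_sign b" for b
        using V.integral_tilted[OF int1, of b] by (simp add: c_def \<mu>)
      show "Q.variance b (\<lambda>x. x) = w + d * bool_sign b" for b
        unfolding w_def d_def by (rule bool_sign_affine)
    qed
    moreover have "char L t = exp (- ((t / \<sigma>)\<^sup>2 * w / 2)) / sqrt (1 + (c * (t / \<sigma>))\<^sup>2)"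
      unfolding L_def using \<open>0 \<le> w\<close> by (subst char_normal_mixture) (simp_all add: power_divide)
    ultimately show "(\<lambda>n. char (distr ?N borel
        (\<lambda>\<omega>. ((\<Sum>k\<in>{1..n}. \<omega> k) - real n * \<mu>) / (\<sigma> * sqrt (real n)))) t) \<longlonglongrightarrow> char L t"
      by simp
  qed simp
  moreover have "\<not> is_normal_distribution L"
    unfolding L_def using \<open>0 < c\<close> \<open>\<sigma> \<noteq> 0\<close> \<open>0 \<le> w\<close> by (intro normal_mixture_not_normal) auto
  moreover have "real_distribution L"
    unfolding L_def by (rule real_distribution_normal_mixture)
  ultimately show ?thesis
    unfolding \<mu>_def \<sigma>_def
    using N.prob_space_axioms distr tuplewise_indep_edge_mixture measurable_edge_mixture
    by (intro exI[of _ ?N] exI[of _ "\<lambda>k \<omega>. \<omega> k"] exI[of _ L]) blast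
qed

end
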